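(* Let $f_i:\mathbb{R}^d\to\mathbb{R}$ be convex and $L_i$-smooth with $L_i>0$ for $i=1,\dots,n$, and let $\psi:\mathbb{R}^d\to\mathbb{R}\cup\{+\infty\}$ be proper, closed and $\mu$-strongly convex with $\mu>0$. Let $\bar L=\frac1n\sum_{i=1}^n L_i$, $n_i=\lceil L_i/\bar L\rceil$ and $N=n_1+\dots+n_n$, and consider the finite-sum problem with $N$ component functions $$\min_{x\in\mathbb{R}^d}\ \frac1N\sum_{i=1}^n\Bigl(\underbrace{\tfrac1{n_i}f_i(x)+\dots+\tfrac1{n_i}f_i(x)}_{n_i\text{ times}}\Bigr)+\psi(x),$$ whose minimizer is denoted $x_\ast$. Then: (1) $N\le 2n$. (2) There is an absolute constant $C>0$ such that the following holds. Let $\varepsilon>0$, let ProxRR or ProxSO be applied to this problem (with its $N$ component functions) from $x_0\in\mathbb{R}^d$, with constant stepsize $\gamma>0$ satisfying $\gamma=\min\bigl\{\frac1{\bar L},\frac{\sqrt{\varepsilon\mu}}{\sigma_{\mathrm{rad}}}\bigr\}$, where $\sigma_{\mathrm{rad}}=\sqrt{\sigma_{\mathrm{rad}}^2(\gamma)}$ is the shuffling radius of this problem (the second term in the minimum is $+\infty$ if $\sigma_{\mathrm{rad}}=0$). If the total number of iterations $K=NT$ ($T$ being the number of epochs) satisfies $$K\ge\Bigl(\frac{\bar L}{\mu}+\frac{\sigma_{\mathrm{rad}}/\mu}{\sqrt{\varepsilon\mu}}+N\Bigr)\log\Bigl(\frac{2\|x_0-x_\ast\|^2}{\varepsilon}\Bigr),$$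 then $\mathbb{E}\|x_T-x_\ast\|^2\le C\varepsilon$.
   Context: A differentiable function $\phi:\mathbb{R}^d\to\mathbb{R}$ has Bregman divergence $D_\phi(x,y)=\phi(x)-\phi(y)-\langle\nabla\phi(y),x-y\rangle$; it is $L$-smooth if it is continuously differentiable and $D_\phi(x,y)\le\frac L2\|x-y\|^2$ for all $x,y$. An extended-real-valued function $\psi$ is $\mu$-strongly convex if $\psi-\frac\mu2\|\cdot\|^2$ is convex. $\mathrm{prox}_{\eta\psi}(x)=\arg\min_{z}\{\eta\psi(z)+\frac12\|z-x\|^2\}$. For a problem $\min_x\frac1N\sum_{k=1}^N g_k(x)+\psi(x)$ with minimizer $x_\ast$ (here $g_1,\dots,g_N$ is the list containing, for each $i$, exactly $n_i$ copies of $\frac1{n_i}f_i$): Algorithm (ProxRR / ProxSO) with constant stepsize $\gamma$: for each epoch $t=0,1,\dots,T-1$, take a permutation $\pi=(\pi_0,\dots,\pi_{N-1})$ of $\{1,\dots,N\}$; set $x_t^0=x_t$; for $k=0,\dots,N-1$ set $x_t^{k+1}=x_t^k-\gamma\nabla g_{\pi_k}(x_t^k)$; then set $x_{t+1}=\mathrm{prox}_{\gamma N\psi}(x_t^N)$. In ProxRR a fresh uniformly random permutation is sampled independently at every epoch; in ProxSO a single uniformly random permutation is sampled once and used in all epochs. Shuffling radius: with $x_\ast^k=x_\ast-\gamma\sum_{j=0}^{k-1}\nabla g_{\pi_j}(x_\ast)$ for $k=1,\dots,N-1$, $$\sigma_{\mathrm{rad}}^2(\gamma)=\max_{k=1,\dots,N-1}\frac1{\gamma^2}\mathbb{E}_\pi\bigl[D_{g_{\pi_k}}(x_\ast^k,x_\ast)\bigr],$$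 with expectation over a uniformly random permutation $\pi$ (a maximum over the empty set is $0$). *)

theory Defs
  imports
    "HOL-Analysis.Analysis"
    "HOL-Probability.Probability"
    "HOL-Combinatorics.Permutations"
    "HOL-Library.Function_Algebras"
begin

text \<open>
  The constant in the theorem is absolute, in particular independent of the dimension, so the
  dimension is a natural number that is quantified inside the formula. Following the library's
  \<^const>\<open>Euclidean_space\<close>, \<open>\<real>\<^sup>d\<close> is the set of all real sequences that vanish from index
  \<open>d\<close> on. On this set the topology of the function type (the product topology) is the usual
  one, so \<^const>\<open>closed\<close>, \<^const>\<open>continuous_on\<close> and the filter \<open>at x within RR d\<close> have their usual
  meaning. Addition and subtraction of vectors are pointwise. Functions on \<open>\<real>\<^sup>d\<close> are total
  functions on sequences whose values outside of \<open>RR d\<close> play no role.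
\<close>

abbreviation RR :: "nat \<Rightarrow> (nat \<Rightarrow> real) set" where
  "RR d \<equiv> topspace (Euclidean_space d)"

definition einner :: "nat \<Rightarrow> (nat \<Rightarrow> real) \<Rightarrow> (nat \<Rightarrow> real) \<Rightarrow> real" where
  "einner d x y = (\<Sum>i<d. x i * y i)"

definition enorm :: "nat \<Rightarrow> (nat \<Rightarrow> real) \<Rightarrow> real" where
  "enorm d x = L2_set x {..<d}"

definition has_gradient ::
  "nat \<Rightarrow> ((nat \<Rightarrow> real) \<Rightarrow> real) \<Rightarrow> (nat \<Rightarrow> real) \<Rightarrow> (nat \<Rightarrow> real) \<Rightarrow> bool" where
  "has_gradient d \<phi> G x \<longleftrightarrow> G \<in> RR d \<and>
     ((\<lambda>y. (\<phi> y - \<phi> x - einner d G (y - x)) / enorm d (y - x)) \<longlongrightarrow> 0) (at x within RR d)"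

definition grad :: "nat \<Rightarrow> ((nat \<Rightarrow> real) \<Rightarrow> real) \<Rightarrow> (nat \<Rightarrow> real) \<Rightarrow> (nat \<Rightarrow> real)" where
  "grad d \<phi> x = (THE G. has_gradient d \<phi> G x)"

definition bregman ::
  "nat \<Rightarrow> ((nat \<Rightarrow> real) \<Rightarrow> real) \<Rightarrow> (nat \<Rightarrow> real) \<Rightarrow> (nat \<Rightarrow> real) \<Rightarrow> real" where
  "bregman d \<phi> x y = \<phi> x - \<phi> y - einner d (grad d \<phi> y) (x - y)"

definition smooth :: "nat \<Rightarrow> real \<Rightarrow> ((nat \<Rightarrow> real) \<Rightarrow> real) \<Rightarrow> bool" where
  "smooth d L \<phi> \<longleftrightarrow>
     (\<forall>x\<in>RR d. \<exists>G. has_gradient d \<phi> G x) \<and> continuous_on (RR d) (grad d \<phi>) \<and>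
     (\<forall>x\<in>RR d. \<forall>y\<in>RR d. bregman d \<phi> x y \<le> L / 2 * (enorm d (x - y))\<^sup>2)"

text \<open>
  The weights \<open>u\<close> and \<open>1 - u\<close> are strictly positive, so that no product \<open>0 * \<infinity>\<close> occurs; the
  functions to which this is applied do not take the value \<open>-\<infinity>\<close>.
\<close>

definition convex_fun :: "nat \<Rightarrow> ((nat \<Rightarrow> real) \<Rightarrow> ereal) \<Rightarrow> bool" where
  "convex_fun d h \<longleftrightarrow>
     (\<forall>x\<in>RR d. \<forall>y\<in>RR d. \<forall>u::real. 0 < u \<and> u < 1 \<longrightarrow>
        h (\<lambda>i. u * x i + (1 - u) * y i) \<le> ereal u * h x + ereal (1 - u) * h y)"

definition strongly_convex_fun :: "nat \<Rightarrow> real \<Rightarrow> ((nat \<Rightarrow> real) \<Rightarrow> ereal) \<Rightarrow> bool" where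
  "strongly_convex_fun d \<mu> h \<longleftrightarrow> convex_fun d (\<lambda>x. h x - ereal (\<mu> / 2 * (enorm d x)\<^sup>2))"

definition proper_fun :: "nat \<Rightarrow> ((nat \<Rightarrow> real) \<Rightarrow> ereal) \<Rightarrow> bool" where
  "proper_fun d h \<longleftrightarrow> (\<forall>x\<in>RR d. h x \<noteq> -\<infinity>) \<and> (\<exists>x\<in>RR d. h x \<noteq> \<infinity>)"

definition closed_fun :: "nat \<Rightarrow> ((nat \<Rightarrow> real) \<Rightarrow> ereal) \<Rightarrow> bool" where
  "closed_fun d h \<longleftrightarrow> closed {(x, r::real). x \<in> RR d \<and> h x \<le> ereal r}"

definition prox ::
  "nat \<Rightarrow> real \<Rightarrow> ((nat \<Rightarrow> real) \<Rightarrow> ereal) \<Rightarrow> (nat \<Rightarrow> real) \<Rightarrow> (nat \<Rightarrow> real)" where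
  "prox d \<eta> \<psi> x =
     arg_min (\<lambda>z. ereal \<eta> * \<psi> z + ereal (1 / 2 * (enorm d (z - x))\<^sup>2)) (\<lambda>z. z \<in> RR d)"

text \<open>
  A finite-sum problem is given by the list of its component functions and the regularizer.
  Components are numbered from 0, so permutations act on \<open>{..<N}\<close>.
\<close>

definition objective ::
  "((nat \<Rightarrow> real) \<Rightarrow> real) list \<Rightarrow> ((nat \<Rightarrow> real) \<Rightarrow> ereal) \<Rightarrow> (nat \<Rightarrow> real) \<Rightarrow> ereal" where
  "objective gs \<psi> x = ereal ((\<Sum>g\<leftarrow>gs. g x) / real (length gs)) + \<psi> x"

definition minimizer ::
  "nat \<Rightarrow> ((nat \<Rightarrow> real) \<Rightarrow> real) list \<Rightarrow> ((nat \<Rightarrow> real) \<Rightarrow> ereal) \<Rightarrow> (nat \<Rightarrow> real) \<Rightarrow> bool" where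
  "minimizer d gs \<psi> x \<longleftrightarrow> is_arg_min (objective gs \<psi>) (\<lambda>z. z \<in> RR d) x"

definition random_perm :: "nat \<Rightarrow> (nat \<Rightarrow> nat) pmf" where
  "random_perm N = pmf_of_set {\<pi>. \<pi> permutes {..<N}}"

primrec inner_iterate ::
  "nat \<Rightarrow> ((nat \<Rightarrow> real) \<Rightarrow> real) list \<Rightarrow> real \<Rightarrow> (nat \<Rightarrow> nat) \<Rightarrow> (nat \<Rightarrow> real) \<Rightarrow> nat \<Rightarrow> (nat \<Rightarrow> real)" where
  "inner_iterate d gs \<gamma> \<pi> x 0 = x"
| "inner_iterate d gs \<gamma> \<pi> x (Suc k) =
     (let y = inner_iterate d gs \<gamma> \<pi> x k in (\<lambda>i. y i - \<gamma> * grad d (gs ! \<pi> k) y i))"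

definition epoch ::
  "nat \<Rightarrow> ((nat \<Rightarrow> real) \<Rightarrow> real) list \<Rightarrow> ((nat \<Rightarrow> real) \<Rightarrow> ereal) \<Rightarrow> real \<Rightarrow> (nat \<Rightarrow> nat) \<Rightarrow>
   (nat \<Rightarrow> real) \<Rightarrow> (nat \<Rightarrow> real)" where
  "epoch d gs \<psi> \<gamma> \<pi> x =
     prox d (\<gamma> * real (length gs)) \<psi> (inner_iterate d gs \<gamma> \<pi> x (length gs))"

text \<open>The distribution of the iterate after \<open>t\<close> epochs.\<close>

primrec prox_rr ::
  "nat \<Rightarrow> ((nat \<Rightarrow> real) \<Rightarrow> real) list \<Rightarrow> ((nat \<Rightarrow> real) \<Rightarrow> ereal) \<Rightarrow> real \<Rightarrow> (nat \<Rightarrow> real) \<Rightarrow> nat \<Rightarrow>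
   (nat \<Rightarrow> real) pmf" where
  "prox_rr d gs \<psi> \<gamma> x0 0 = return_pmf x0"
| "prox_rr d gs \<psi> \<gamma> x0 (Suc t) =
     bind_pmf (prox_rr d gs \<psi> \<gamma> x0 t)
       (\<lambda>x. map_pmf (\<lambda>\<pi>. epoch d gs \<psi> \<gamma> \<pi> x) (random_perm (length gs)))"

definition prox_so ::
  "nat \<Rightarrow> ((nat \<Rightarrow> real) \<Rightarrow> real) list \<Rightarrow> ((nat \<Rightarrow> real) \<Rightarrow> ereal) \<Rightarrow> real \<Rightarrow> (nat \<Rightarrow> real) \<Rightarrow> nat \<Rightarrow>
   (nat \<Rightarrow> real) pmf" where
  "prox_so d gs \<psi> \<gamma> x0 t =
     map_pmf (\<lambda>\<pi>. (epoch d gs \<psi> \<gamma> \<pi> ^^ t) x0) (random_perm (length gs))"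

definition sol_iterate ::
  "nat \<Rightarrow> ((nat \<Rightarrow> real) \<Rightarrow> real) list \<Rightarrow> real \<Rightarrow> (nat \<Rightarrow> nat) \<Rightarrow> (nat \<Rightarrow> real) \<Rightarrow> nat \<Rightarrow> (nat \<Rightarrow> real)" where
  "sol_iterate d gs \<gamma> \<pi> xs k = (\<lambda>i. xs i - \<gamma> * (\<Sum>j<k. grad d (gs ! \<pi> j) xs i))"

definition sigma_rad_sq ::
  "nat \<Rightarrow> ((nat \<Rightarrow> real) \<Rightarrow> real) list \<Rightarrow> real \<Rightarrow> (nat \<Rightarrow> real) \<Rightarrow> real" where
  "sigma_rad_sq d gs \<gamma> xs =
     (if length gs \<le> 1 then 0
      else Max ((\<lambda>k. 1 / \<gamma>\<^sup>2 * measure_pmf.expectation (random_perm (length gs))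
                    (\<lambda>\<pi>. bregman d (gs ! \<pi> k) (sol_iterate d gs \<gamma> \<pi> xs k) xs))
                ` {1..<length gs}))"

definition sigma_rad ::
  "nat \<Rightarrow> ((nat \<Rightarrow> real) \<Rightarrow> real) list \<Rightarrow> real \<Rightarrow> (nat \<Rightarrow> real) \<Rightarrow> real" where
  "sigma_rad d gs \<gamma> xs = sqrt (sigma_rad_sq d gs \<gamma> xs)"

definition Lbar :: "nat \<Rightarrow> (nat \<Rightarrow> real) \<Rightarrow> real" where
  "Lbar n L = (\<Sum>i<n. L i) / real n"

definition copies :: "nat \<Rightarrow> (nat \<Rightarrow> real) \<Rightarrow> nat \<Rightarrow> nat" where
  "copies n L i = nat \<lceil>L i / Lbar n L\<rceil>"

definition num_components :: "nat \<Rightarrow> (nat \<Rightarrow> real) \<Rightarrow> nat" where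
  "num_components n L = (\<Sum>i<n. copies n L i)"

definition component_list ::
  "nat \<Rightarrow> (nat \<Rightarrow> real) \<Rightarrow> (nat \<Rightarrow> (nat \<Rightarrow> real) \<Rightarrow> real) \<Rightarrow> ((nat \<Rightarrow> real) \<Rightarrow> real) list" where
  "component_list n L f =
     concat (map (\<lambda>i. replicate (copies n L i) (\<lambda>x. 1 / real (copies n L i) * f i x)) [0..<n])"

definition problem_setting ::
  "nat \<Rightarrow> nat \<Rightarrow> (nat \<Rightarrow> (nat \<Rightarrow> real) \<Rightarrow> real) \<Rightarrow> (nat \<Rightarrow> real) \<Rightarrow> ((nat \<Rightarrow> real) \<Rightarrow> ereal) \<Rightarrow> real \<Rightarrow> bool" where
  "problem_setting d n f L \<psi> \<mu> \<longleftrightarrow>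
     n \<ge> 1 \<and>
     (\<forall>i<n. L i > 0 \<and> convex_fun d (\<lambda>x. ereal (f i x)) \<and> smooth d (L i) (f i)) \<and>
     \<mu> > 0 \<and> proper_fun d \<psi> \<and> closed_fun d \<psi> \<and> strongly_convex_fun d \<mu> \<psi>"

end

theory Submission
  imports Defs
begin

text \<open>
  Each component \<open>g\<close> of the resampled problem is convex and \<open>Lbar\<close>-smooth, since
  \<open>L i / copies n L i \<le> Lbar\<close>. Compare the inner iterates of an epoch with the points
  \<open>sol_iterate\<close> obtained by stepping along the gradients at the minimizer \<open>xs\<close>. The three-point
  identity and cocoercivity show that, for \<open>\<gamma> \<le> 1 / Lbar\<close>, an inner step increases the squared
  distance by at most \<open>2 \<gamma> D\<close>, where \<open>D\<close> is the Bregman divergence between \<open>sol_iterate\<close> and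
  \<open>xs\<close>, whose expectation is at most \<open>\<gamma>\<^sup>2 \<sigma>\<^sup>2\<close>. First-order optimality makes \<open>xs\<close> the proximal
  point of the last \<open>sol_iterate\<close>, so by strong convexity the proximal step contracts squared
  distances by \<open>1 / (1 + 2 \<gamma> N \<mu>)\<close>. For both sampling schemes the recursion yields
  \<open>E |x\<^sub>T - xs|\<^sup>2 \<le> (1 + 2 \<gamma> N \<mu>)\<^sup>-\<^sup>T |x\<^sub>0 - xs|\<^sup>2 + \<gamma>\<^sup>2 \<sigma>\<^sup>2 / \<mu>\<close>, and under the prescribed
  step size and number of epochs the two terms are at most \<open>\<epsilon> / 2\<close> and \<open>\<epsilon>\<close>.
\<close>

subsection \<open>Gradients and Bregman divergences\<close>

lemma RR_iff: "x \<in> RR d \<longleftrightarrow> (\<forall>i\<ge>d. x i = 0)"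
  by (simp add: topspace_Euclidean_space)

lemma RR_diff [intro]: "x \<in> RR d \<Longrightarrow> y \<in> RR d \<Longrightarrow> x - y \<in> RR d"
  by (simp add: RR_iff)

lemma RR_add_scaled: "x \<in> RR d \<Longrightarrow> v \<in> RR d \<Longrightarrow> (\<lambda>i. x i + c * v i) \<in> RR d"
  by (simp add: RR_iff)

lemma RR_combination: "x \<in> RR d \<Longrightarrow> v \<in> RR d \<Longrightarrow> (\<lambda>i. a * x i + c * v i) \<in> RR d"
  by (simp add: RR_iff)

lemma einner_commute: "einner d x y = einner d y x"
  by (simp add: einner_def mult.commute)

lemma einner_linear_left:
  "einner d (x - y) z = einner d x z - einner d y z"
  "einner d (\<lambda>i. u i - v i) z = einner d u z - einner d v z"
  "einner d (\<lambda>i. u i + v i) z = einner d u z + einner d v z"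
  "einner d (\<lambda>i. c * u i) z = c * einner d u z"
  "einner d (\<lambda>i. \<Sum>j\<in>J. w j i) z = (\<Sum>j\<in>J. einner d (w j) z)"
proof -
  show "einner d (\<lambda>i. \<Sum>j\<in>J. w j i) z = (\<Sum>j\<in>J. einner d (w j) z)"
    unfolding einner_def sum_distrib_right by (rule sum.swap)
qed (simp_all add: einner_def algebra_simps sum.distrib sum_subtractf sum_distrib_left)

lemma einner_linear_right:
  "einner d z (x - y) = einner d z x - einner d z y"
  "einner d z (\<lambda>i. u i - v i) = einner d z u - einner d z v"
  "einner d z (\<lambda>i. u i + v i) = einner d z u + einner d z v"
  "einner d z (\<lambda>i. c * u i) = c * einner d z u"
  by (simp_all only: einner_commute[of d z] einner_linear_left)

lemma enorm_sq: "(enorm d x)\<^sup>2 = einner d x x"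
  by (simp add: enorm_def L2_set_def einner_def sum_nonneg power2_eq_square)

lemmas einner_simps = enorm_sq einner_linear_left einner_linear_right

lemma enorm_nonneg [simp]: "0 \<le> enorm d x"
  by (simp add: enorm_def)

lemma enorm_scale: "0 \<le> c \<Longrightarrow> enorm d (\<lambda>i. c * x i) = c * enorm d x"
  by (simp add: enorm_def L2_set_right_distrib)

lemma einner_le_enorm: "einner d x y \<le> enorm d x * enorm d y"
proof -
  have "einner d x y \<le> (\<Sum>i<d. \<bar>x i\<bar> * \<bar>y i\<bar>)"
    unfolding einner_def by (rule sum_mono) (metis abs_ge_self abs_mult)
  also have "\<dots> \<le> enorm d x * enorm d y"
    unfolding enorm_def by (rule L2_set_mult_ineq)
  finally show ?thesis .
qed

lemma enorm_eq_0_iff: "x \<in> RR d \<Longrightarrow> enorm d x = 0 \<longleftrightarrow> x = (\<lambda>i. 0)"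
  by (auto simp: enorm_def L2_set_eq_0_iff RR_iff fun_eq_iff) (metis lessThan_iff not_le)

text \<open>The function type carries the product topology, so limits are taken coordinatewise. This
  lets the curve \<open>x + t * v\<close> be recognised as approaching \<open>x\<close> in
  \<open>RR d\<close>.\<close>

lemma tendsto_fun_iff:
  fixes f :: "'b \<Rightarrow> 'a \<Rightarrow> 'c::topological_space"
  shows "(f \<longlongrightarrow> l) F \<longleftrightarrow> (\<forall>i. ((\<lambda>c. f c i) \<longlongrightarrow> l i) F)"
  using limitin_componentwise[of "\<lambda>_. euclidean" UNIV f l F]
  by (simp add: euclidean_product_topology flip: limitin_canonical_iff)

text \<open>The limit that defines the gradient is composed with the curve \<open>x + t * v\<close>;
  its remainder is divided by \<open>t * |v|\<close>, so multiplying by \<open>|v|\<close> leaves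
  the difference quotient in \<open>t\<close>.\<close>

lemma has_gradient_directional:
  assumes G: "has_gradient d \<phi> G x" and x: "x \<in> RR d" and v: "v \<in> RR d"
  shows "((\<lambda>t. (\<phi> (\<lambda>i. x i + t * v i) - \<phi> x) / t) \<longlongrightarrow> einner d G v) (at_right 0)"
\<comment> \<open>The filter \<open>at x within RR d\<close> excludes \<open>x\<close> itself, so
  the constant curve needs its own case.\<close>
proof (cases "v = (\<lambda>i. 0)")
  case True
  then show ?thesis by (simp add: einner_def)
next
  case False
  then have n0: "enorm d v \<noteq> 0" using v by (simp add: enorm_eq_0_iff)
  from False obtain j where j: "v j \<noteq> 0" by auto
  let ?p = "\<lambda>t i. x i + t * v i"
  have "(?p \<longlongrightarrow> x) (at_right 0)"
    unfolding tendsto_fun_iff by (auto intro!: tendsto_eq_intros)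
  moreover have "\<forall>\<^sub>F t in at_right 0. ?p t \<in> RR d \<and> ?p t \<noteq> x"
  proof (rule eventually_at_right_less[THEN eventually_mono])
    fix t :: real assume "0 < t"
    then show "?p t \<in> RR d \<and> ?p t \<noteq> x"
      using RR_add_scaled[OF x v] j by (auto simp: fun_eq_iff)
  qed
  ultimately have "filterlim ?p (at x within RR d) (at_right 0)"
    by (simp add: filterlim_at)
  from filterlim_compose[OF G[unfolded has_gradient_def, THEN conjunct2] this]
  have "((\<lambda>t. (\<phi> (?p t) - \<phi> x - einner d G (?p t - x)) / enorm d (?p t - x)) \<longlongrightarrow> 0) (at_right 0)" .
  then have "((\<lambda>t. enorm d v * ((\<phi> (?p t) - \<phi> x - einner d G (?p t - x)) / enorm d (?p t - x))
      + einner d G v) \<longlongrightarrow> enorm d v * 0 + einner d G v) (at_right 0)"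
    by (intro tendsto_intros)
  moreover have "\<forall>\<^sub>F t in at_right 0. enorm d v * ((\<phi> (?p t) - \<phi> x - einner d G (?p t - x))
      / enorm d (?p t - x)) + einner d G v = (\<phi> (?p t) - \<phi> x) / t"
  proof (rule eventually_at_right_less[THEN eventually_mono])
    fix t :: real assume t: "0 < t"
    have "?p t - x = (\<lambda>i. t * v i)" by auto
    then show "enorm d v * ((\<phi> (?p t) - \<phi> x - einner d G (?p t - x))
        / enorm d (?p t - x)) + einner d G v = (\<phi> (?p t) - \<phi> x) / t"
      using t n0 by (simp add: enorm_scale einner_linear_right field_simps)
  qed
  ultimately show ?thesis
    using Lim_transform_eventually by fastforce
qed

text \<open>Both gradients give the same derivative in the direction \<open>G - H\<close>, hence
  \<open>|G - H|^2 = 0\<close>. This makes the definite description in \<open>grad\<close>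
  meaningful.\<close>

lemma has_gradient_unique:
  assumes "has_gradient d \<phi> G x" "has_gradient d \<phi> H x" "x \<in> RR d"
  shows "G = H"
proof -
  have RR: "G \<in> RR d" "H \<in> RR d" using assms by (auto simp: has_gradient_def)
  then have "G - H \<in> RR d" by auto
  note lim = has_gradient_directional[OF _ assms(3) this]
  have "einner d G (G - H) = einner d H (G - H)"
    by (rule tendsto_unique[OF _ lim[OF assms(1)] lim[OF assms(2)]]) simp
  then have "(enorm d (G - H))\<^sup>2 = 0" by (simp add: einner_simps)
  then show ?thesis using RR enorm_eq_0_iff[of "G - H" d] by (auto simp: fun_eq_iff)
qed

lemma grad_eqI: "has_gradient d \<phi> G x \<Longrightarrow> x \<in> RR d \<Longrightarrow> grad d \<phi> x = G"
  unfolding grad_def by (blast intro: has_gradient_unique)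

lemma has_gradient_scale:
  assumes "has_gradient d \<phi> G x"
  shows "has_gradient d (\<lambda>x. c * \<phi> x) (\<lambda>i. c * G i) x"
proof -
  have "((\<lambda>y. c * ((\<phi> y - \<phi> x - einner d G (y - x)) / enorm d (y - x))) \<longlongrightarrow> c * 0) (at x within RR d)"
    using assms unfolding has_gradient_def by (intro tendsto_intros) auto
  then show ?thesis
    using assms by (simp add: has_gradient_def RR_iff einner_linear_left algebra_simps)
qed

lemma smooth_has_gradient:
  "smooth d L \<phi> \<Longrightarrow> x \<in> RR d \<Longrightarrow> has_gradient d \<phi> (grad d \<phi> x) x"
  by (metis smooth_def grad_eqI)

lemma grad_scale:
  assumes "smooth d L \<phi>" "x \<in> RR d"
  shows "grad d (\<lambda>x. c * \<phi> x) x = (\<lambda>i. c * grad d \<phi> x i)"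
  using assms by (intro grad_eqI has_gradient_scale smooth_has_gradient)

lemma bregman_scale:
  assumes "smooth d L \<phi>" "y \<in> RR d"
  shows "bregman d (\<lambda>x. c * \<phi> x) x y = c * bregman d \<phi> x y"
  using assms by (simp add: bregman_def grad_scale einner_linear_left algebra_simps)

text \<open>Convexity bounds every difference quotient from \<open>y\<close> towards
  \<open>x\<close> by \<open>\<phi> x - \<phi> y\<close>; the limit at 0 from the right turns this
  into the gradient inequality.\<close>

lemma bregman_nonneg:
  assumes sm: "smooth d L \<phi>" and cv: "convex_fun d (\<lambda>x. ereal (\<phi> x))"
    and x: "x \<in> RR d" and y: "y \<in> RR d"
  shows "0 \<le> bregman d \<phi> x y"
proof -
  define v where "v = x - y"
  have v: "v \<in> RR d" unfolding v_def using x y by (rule RR_diff)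
  have "einner d (grad d \<phi> y) v \<le> \<phi> x - \<phi> y"
  proof (rule tendsto_upperbound)
    show "((\<lambda>t. (\<phi> (\<lambda>i. y i + t * v i) - \<phi> y) / t) \<longlongrightarrow> einner d (grad d \<phi> y) v) (at_right 0)"
      using sm y v by (intro has_gradient_directional smooth_has_gradient)
    show "\<forall>\<^sub>F t in at_right 0. (\<phi> (\<lambda>i. y i + t * v i) - \<phi> y) / t \<le> \<phi> x - \<phi> y"
      unfolding eventually_at_right_field
    proof (intro exI[of _ 1] conjI allI impI)
      fix t :: real assume t: "0 < t" "t < 1"
      have eq: "(\<lambda>i. t * x i + (1 - t) * y i) = (\<lambda>i. y i + t * v i)"
        by (auto simp: v_def algebra_simps)
      have "ereal (\<phi> (\<lambda>i. t * x i + (1 - t) * y i)) \<le> ereal t * ereal (\<phi> x) + ereal (1 - t) * ereal (\<phi> y)"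
        using cv x y t unfolding convex_fun_def by blast
      then have "\<phi> (\<lambda>i. y i + t * v i) \<le> t * \<phi> x + (1 - t) * \<phi> y"
        unfolding eq by simp
      then show "(\<phi> (\<lambda>i. y i + t * v i) - \<phi> y) / t \<le> \<phi> x - \<phi> y"
        using t by (simp add: field_simps)
    qed simp
  qed simp
  then show ?thesis by (simp add: bregman_def v_def)
qed

text \<open>All values of \<open>\<phi>\<close> cancel. It is applied with \<open>a\<close> an inner
  iterate, \<open>b\<close> the minimizer and \<open>c\<close> the corresponding
  \<open>sol_iterate\<close>.\<close>

lemma bregman_three_points:
  "einner d (grad d \<phi> a - grad d \<phi> b) (a - c) =
     bregman d \<phi> c a + bregman d \<phi> a b - bregman d \<phi> c b"
  by (simp add: bregman_def einner_simps)

text \<open>Convexity at \<open>y\<close> and smoothness at \<open>x\<close> are both applied to the gradient step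
  \<open>x - (\<nabla>\<phi>(x) - \<nabla>\<phi>(y)) / M\<close>.\<close>

lemma bregman_cocoercive:
  assumes M: "M > 0" and x: "x \<in> RR d" and y: "y \<in> RR d"
    and gr: "\<And>x. x \<in> RR d \<Longrightarrow> grad d \<phi> x \<in> RR d"
    and lo: "\<And>x y. x \<in> RR d \<Longrightarrow> y \<in> RR d \<Longrightarrow> 0 \<le> bregman d \<phi> x y"
    and up: "\<And>x y. x \<in> RR d \<Longrightarrow> y \<in> RR d \<Longrightarrow> bregman d \<phi> x y \<le> M / 2 * (enorm d (x - y))\<^sup>2"
  shows "(enorm d (grad d \<phi> x - grad d \<phi> y))\<^sup>2 \<le> 2 * M * bregman d \<phi> x y"
proof -
  define w where "w = grad d \<phi> x - grad d \<phi> y"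
  define z where "z = (\<lambda>i. x i + (- (1 / M)) * w i)"
  have "w \<in> RR d" unfolding w_def using x y gr by auto
  then have z: "z \<in> RR d" unfolding z_def by (intro RR_add_scaled x)
  have zx: "z - x = (\<lambda>i. (- (1 / M)) * w i)" by (auto simp: z_def)
  have "bregman d \<phi> x y = bregman d \<phi> z y - bregman d \<phi> z x - einner d w (z - x)"
    by (simp add: bregman_def einner_simps w_def)
  also have "\<dots> \<ge> 0 - M / 2 * (enorm d (z - x))\<^sup>2 - einner d w (z - x)"
    using lo[OF z y] up[OF z x] by linarith
  also have "0 - M / 2 * (enorm d (z - x))\<^sup>2 - einner d w (z - x) = (enorm d w)\<^sup>2 / (2 * M)"
    unfolding zx using M by (simp only: einner_simps) (simp add: field_simps)
  finally show ?thesis using M by (simp add: w_def field_simps)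
qed

subsection \<open>Strong convexity and the proximal operator\<close>

text \<open>Properness excludes the value \<open>-\<infinity>\<close> at the combination and the
  convexity bound excludes \<open>\<infinity>\<close>, so the inequality can be stated over the
  reals. The quadratic gain is the exact convexity defect of the squared norm.\<close>

lemma strongly_convex_combination:
  assumes sc: "strongly_convex_fun d \<mu> h" and pr: "proper_fun d h"
    and x: "x \<in> RR d" and z: "z \<in> RR d" and hx: "h x = ereal a" and hz: "h z = ereal b"
    and u: "0 < u" "u < 1"
  shows "\<exists>c. h (\<lambda>i. u * z i + (1 - u) * x i) = ereal c \<and>
    c \<le> u * b + (1 - u) * a - \<mu> / 2 * u * (1 - u) * (enorm d (z - x))\<^sup>2"
proof -
  let ?w = "\<lambda>i. u * z i + (1 - u) * x i"
  have "?w \<in> RR d" using x z by (intro RR_combination)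
  then have "h ?w \<noteq> -\<infinity>" using pr by (auto simp: proper_fun_def)
  moreover have le: "h ?w - ereal (\<mu> / 2 * (enorm d ?w)\<^sup>2) \<le>
      ereal (u * (b - \<mu> / 2 * (enorm d z)\<^sup>2) + (1 - u) * (a - \<mu> / 2 * (enorm d x)\<^sup>2))"
  proof -
    have "h ?w - ereal (\<mu> / 2 * (enorm d ?w)\<^sup>2) \<le>
        ereal u * (h z - ereal (\<mu> / 2 * (enorm d z)\<^sup>2)) +
        ereal (1 - u) * (h x - ereal (\<mu> / 2 * (enorm d x)\<^sup>2))"
      using sc x z u unfolding strongly_convex_fun_def convex_fun_def by blast
    then show ?thesis by (simp add: hx hz)
  qed
  ultimately obtain c where c: "h ?w = ereal c" by (cases "h ?w") auto
  have "(enorm d ?w)\<^sup>2 = u * (enorm d z)\<^sup>2 + (1 - u) * (enorm d x)\<^sup>2 - u * (1 - u) * (enorm d (z - x))\<^sup>2"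
    by (simp add: einner_simps einner_commute[of d z x] algebra_simps)
  then have "u * (b - \<mu> / 2 * (enorm d z)\<^sup>2) + (1 - u) * (a - \<mu> / 2 * (enorm d x)\<^sup>2) +
      \<mu> / 2 * (enorm d ?w)\<^sup>2 = u * b + (1 - u) * a - \<mu> / 2 * u * (1 - u) * (enorm d (z - x))\<^sup>2"
    by (simp only:) (simp add: field_simps)
  moreover have "c - \<mu> / 2 * (enorm d ?w)\<^sup>2 \<le>
      u * (b - \<mu> / 2 * (enorm d z)\<^sup>2) + (1 - u) * (a - \<mu> / 2 * (enorm d x)\<^sup>2)"
    using le c by simp
  ultimately have "c \<le> u * b + (1 - u) * a - \<mu> / 2 * u * (1 - u) * (enorm d (z - x))\<^sup>2"
    by linarith
  with c show ?thesis by blast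
qed

lemma nonneg_if_affine_nonneg:
  fixes A B :: real
  assumes "\<And>u. 0 < u \<Longrightarrow> u < 1 \<Longrightarrow> 0 \<le> A + u * B"
  shows "0 \<le> A"
proof (rule tendsto_lowerbound)
  show "((\<lambda>u. A + u * B) \<longlongrightarrow> A) (at_right 0)" by (auto intro!: tendsto_eq_intros)
  show "\<forall>\<^sub>F u in at_right 0. 0 \<le> A + u * B"
    unfolding eventually_at_right_field using assms by (intro exI[of _ 1]) auto
qed simp

text \<open>First-order optimality without subdifferential calculus: if \<open>F\<close> has a
  quadratic upper model with slope \<open>G\<close> at a minimizer \<open>x\<close> of
  \<open>F + h\<close>, then \<open>-G\<close> is a strong subgradient of \<open>h\<close> at
  \<open>x\<close>. The minimizer is compared with points on the segment towards
  \<open>z\<close>.\<close>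

lemma strongly_convex_minimizer_bound:
  assumes sc: "strongly_convex_fun d \<mu> h" and pr: "proper_fun d h"
    and x: "x \<in> RR d" and z: "z \<in> RR d" and hx: "h x = ereal a" and hz: "h z = ereal b"
    and F: "\<And>z. z \<in> RR d \<Longrightarrow> F z \<le> F x + einner d G (z - x) + c * (enorm d (z - x))\<^sup>2"
    and min: "\<And>z. z \<in> RR d \<Longrightarrow> ereal (F x) + h x \<le> ereal (F z) + h z"
  shows "a - einner d G (z - x) + \<mu> / 2 * (enorm d (z - x))\<^sup>2 \<le> b"
proof -
  define v where "v = z - x"
  define q where "q = (enorm d v)\<^sup>2"
  have "0 \<le> (b - a + einner d G v - \<mu> / 2 * q) + u * ((c + \<mu> / 2) * q)"
    if u: "0 < u" "u < 1" for u
  proof -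
    let ?w = "\<lambda>i. u * z i + (1 - u) * x i"
    have w: "?w \<in> RR d" using x z by (intro RR_combination)
    obtain e where e: "h ?w = ereal e" "e \<le> u * b + (1 - u) * a - \<mu> / 2 * u * (1 - u) * q"
      using strongly_convex_combination[OF sc pr x z hx hz u] by (auto simp: q_def v_def)
    have wx: "?w - x = (\<lambda>i. u * v i)" by (auto simp: v_def algebra_simps)
    have "F x + a \<le> F ?w + e" using min[OF w] e hx by simp
    moreover have "F ?w \<le> F x + u * einner d G v + c * (u\<^sup>2 * q)"
      using F[OF w] u unfolding wx einner_linear_right(4) q_def
      by (simp add: enorm_scale power_mult_distrib)
    \<comment> \<open>One factor \<open>u\<close> splits off. After dividing by it, only the
      constant term survives as \<open>u\<close> tends to 0, and that term is the claim.\<close>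
    moreover have "u * ((b - a + einner d G v - \<mu> / 2 * q) + u * ((c + \<mu> / 2) * q)) =
        (u * b + (1 - u) * a - \<mu> / 2 * u * (1 - u) * q) - a + u * einner d G v + c * (u\<^sup>2 * q)"
      by (simp add: field_simps power2_eq_square)
    ultimately have "0 \<le> u * ((b - a + einner d G v - \<mu> / 2 * q) + u * ((c + \<mu> / 2) * q))"
      using e by linarith
    then show ?thesis using u by (simp add: zero_le_mult_iff)
  qed
  from nonneg_if_affine_nonneg[OF this] show ?thesis by (simp add: q_def v_def)
qed

section \<open>Existence of proximal points by compactness\<close>

lemma continuous_on_einner:
  assumes "continuous_on S f" "continuous_on S g"
  shows "continuous_on S (\<lambda>x. einner d (f x) (g x))"
  unfolding einner_def
  by (intro continuous_on_sum continuous_on_mult continuous_on_product_then_coordinatewise[OF assms(1)]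
      continuous_on_product_then_coordinatewise[OF assms(2)])

text \<open>Tychonoff's theorem for a box in the function space; it stands in for Heine-Borel on
  \<open>RR d\<close>.\<close>

lemma compact_box_fun:
  fixes S :: "'i \<Rightarrow> 'a::topological_space set"
  assumes "\<And>i. compact (S i)"
  shows "compact {z. \<forall>i. z i \<in> S i}"
proof -
  have "compactin (product_topology (\<lambda>i. euclidean) UNIV) (PiE UNIV S)"
    using assms by (simp add: compactin_PiE)
  moreover have "PiE UNIV S = {z. \<forall>i. z i \<in> S i}" by auto
  ultimately show ?thesis by (simp add: euclidean_product_topology)
qed

text \<open>Closedness of \<open>\<psi>\<close> is given through its epigraph, so the objective is
  replaced by the continuous function \<open>H\<close> on the epigraph, where an infimum over a
  compact set is attained. The affine minorant \<open>lower\<close> bounds the relevant sublevel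
  set.\<close>

lemma prox_minimizer_exists:
  assumes cl: "closed_fun d \<psi>" and pr: "proper_fun d \<psi>" and \<eta>: "0 < \<eta>"
    and lower: "\<And>z. z \<in> RR d \<Longrightarrow> ereal (a + einner d w z) \<le> \<psi> z"
  shows "\<exists>p. is_arg_min (\<lambda>z. ereal \<eta> * \<psi> z + ereal (1 / 2 * (enorm d (z - y))\<^sup>2)) (\<lambda>z. z \<in> RR d) p"
proof -
  define E where "E = {(z, r::real). z \<in> RR d \<and> \<psi> z \<le> ereal r}"
  define H where "H = (\<lambda>q. \<eta> * snd q + 1 / 2 * (enorm d (fst q - y))\<^sup>2)"
  have contH: "continuous_on UNIV H"
  proof -
    have "continuous_on UNIV (\<lambda>q::(nat \<Rightarrow> real) \<times> real. fst q i)" for i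
      by (intro continuous_on_product_then_coordinatewise[of UNIV fst] continuous_on_fst continuous_on_id)
    then have "continuous_on UNIV (\<lambda>q::(nat \<Rightarrow> real) \<times> real. fst q - y)"
      unfolding fun_diff_def
      by (intro continuous_on_coordinatewise_then_product continuous_on_diff continuous_on_const)
    from continuous_on_einner[OF this this] show ?thesis
      unfolding H_def enorm_sq
      by (intro continuous_on_add continuous_on_mult continuous_on_const continuous_on_snd continuous_on_id)
  qed
  obtain z0 where z0: "z0 \<in> RR d" "\<psi> z0 \<noteq> \<infinity>" using pr by (auto simp: proper_fun_def)
  then obtain b0 where b0: "\<psi> z0 = ereal b0" using pr by (cases "\<psi> z0") (auto simp: proper_fun_def)
  define E' where "E' = E \<inter> {q. H q \<le> H (z0, b0)}"
  have ne: "E' \<noteq> {}" using z0 b0 by (auto simp: E'_def E_def)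
  define c where "c = (\<lambda>i. \<eta> * w i)"
  \<comment> \<open>Bound on \<open>|z - y|^2\<close> over the sublevel set, obtained below by
    expanding \<open>0 <= |(z - y) / 2 + c|^2\<close> to absorb the linear term.\<close>
  define B where "B = 4 * (H (z0, b0) - \<eta> * a - einner d c y + (enorm d c)\<^sup>2)"
  define R where "R = (\<lambda>i. \<bar>y i\<bar> + sqrt B)"
  \<comment> \<open>Coordinates from \<open>d\<close> on are fixed at 0, which keeps the box compact
    in the full sequence space.\<close>
  define S where "S = (\<lambda>i. if i < d then {- R i..R i} else {0})"
  define lo where "lo = a - (\<Sum>i<d. \<bar>w i\<bar> * R i)"
  have sub: "E' \<subseteq> {z. \<forall>i. z i \<in> S i} \<times> {lo..H (z0, b0) / \<eta>}"
  proof
    fix q assume "q \<in> E'"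
    then obtain z r where q: "q = (z, r)" and z: "z \<in> RR d" and r: "\<psi> z \<le> ereal r"
      and Hq: "\<eta> * r + 1 / 2 * (enorm d (z - y))\<^sup>2 \<le> H (z0, b0)"
      by (cases q) (auto simp: E'_def E_def H_def)
    have "ereal (a + einner d w z) \<le> ereal r" using lower[OF z] r by (rule order_trans)
    then have ar: "a + einner d w z \<le> r" by simp
    then have "\<eta> * (a + einner d w z) \<le> \<eta> * r" using \<eta> by simp
    moreover have "\<eta> * einner d w z = einner d c (z - y) + einner d c y"
      by (simp add: c_def einner_simps algebra_simps)
    ultimately have 1: "\<eta> * a + einner d c (z - y) + einner d c y + 1 / 2 * (enorm d (z - y))\<^sup>2 \<le> H (z0, b0)"
      using Hq by (simp add: distrib_left)
    define t where "t = z - y"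
    have "0 \<le> (enorm d (\<lambda>i. 1 / 2 * t i + c i))\<^sup>2" by simp
    also have "\<dots> = 1 / 4 * (enorm d t)\<^sup>2 + einner d c t + (enorm d c)\<^sup>2"
      by (simp only: einner_simps einner_commute[of d t c]) (simp add: field_simps)
    finally have tB: "(enorm d t)\<^sup>2 \<le> B" using 1 by (simp add: B_def t_def)
    have zR: "\<bar>z i\<bar> \<le> R i" if "i < d" for i
    proof -
      have "(t i)\<^sup>2 \<le> (enorm d t)\<^sup>2"
        unfolding enorm_sq unfolding einner_def power2_eq_square
        using that by (intro member_le_sum) auto
      then have "\<bar>t i\<bar> \<le> sqrt B" using tB by (intro real_le_rsqrt) simp
      then show ?thesis by (simp add: t_def R_def)
    qed
    have "z i \<in> S i" for i
      using zR[of i] z by (auto simp: S_def RR_iff abs_le_iff)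
    moreover have "\<eta> * r \<le> H (z0, b0)" using Hq zero_le_power2[of "enorm d (z - y)"] by linarith
    then have "r \<le> H (z0, b0) / \<eta>" using \<eta> by (simp add: pos_le_divide_eq mult.commute)
    moreover have "- (\<Sum>i<d. \<bar>w i\<bar> * R i) \<le> einner d w z"
      unfolding einner_def sum_negf[symmetric]
    proof (rule sum_mono)
      fix i assume "i \<in> {..<d}"
      then have "\<bar>w i * z i\<bar> \<le> \<bar>w i\<bar> * R i" using zR[of i] by (simp add: abs_mult mult_left_mono)
      then show "- (\<bar>w i\<bar> * R i) \<le> w i * z i" by linarith
    qed
    ultimately show "q \<in> {z. \<forall>i. z i \<in> S i} \<times> {lo..H (z0, b0) / \<eta>}"
      using ar by (simp add: q lo_def)
  qed
  have "closed E'"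
    using cl unfolding E'_def closed_fun_def E_def
    by (intro closed_Int closed_Collect_le contH continuous_intros)
  moreover have "compact ({z. \<forall>i. z i \<in> S i} \<times> {lo..H (z0, b0) / \<eta>})"
    by (intro compact_Times compact_box_fun) (auto simp: S_def)
  ultimately have "compact (({z. \<forall>i. z i \<in> S i} \<times> {lo..H (z0, b0) / \<eta>}) \<inter> E')"
    by (rule compact_Int_closed[rotated])
  then have "compact E'" using sub by (simp add: Int_absorb1)
  then obtain q where q: "q \<in> E'" "\<And>q'. q' \<in> E' \<Longrightarrow> H q \<le> H q'"
    using continuous_attains_inf[of E' H] ne continuous_on_subset[OF contH] by blast
  \<comment> \<open>Points of the epigraph outside \<open>E'\<close> have a value above
    \<open>H (z0, b0)\<close>, which already dominates \<open>H q\<close>.\<close>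
  have qmin: "H q \<le> H q'" if "q' \<in> E" for q'
    using q that by (cases "H q' \<le> H (z0, b0)") (auto simp: E'_def)
  obtain p s where ps: "q = (p, s)" by (cases q)
  have p: "p \<in> RR d" "\<psi> p \<le> ereal s" using q(1) by (auto simp: ps E'_def E_def)
  have "ereal \<eta> * \<psi> p + ereal (1 / 2 * (enorm d (p - y))\<^sup>2)
      \<le> ereal \<eta> * \<psi> z + ereal (1 / 2 * (enorm d (z - y))\<^sup>2)" if z: "z \<in> RR d" for z
  proof (cases "\<psi> z")
    case (real b)
    then have "(z, b) \<in> E" using z by (simp add: E_def)
    from qmin[OF this] have "\<eta> * s + 1 / 2 * (enorm d (p - y))\<^sup>2 \<le> \<eta> * b + 1 / 2 * (enorm d (z - y))\<^sup>2"
      by (simp add: H_def ps)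
    moreover have "ereal \<eta> * \<psi> p \<le> ereal (\<eta> * s)"
      using ereal_mult_left_mono[OF p(2), of "ereal \<eta>"] \<eta> by simp
    then have "ereal \<eta> * \<psi> p + ereal (1 / 2 * (enorm d (p - y))\<^sup>2) \<le>
        ereal (\<eta> * s) + ereal (1 / 2 * (enorm d (p - y))\<^sup>2)"
      by (rule add_right_mono)
    ultimately show ?thesis using real by (simp add: order_trans)
  next
    case PInf
    then show ?thesis using \<eta> by simp
  next
    case MInf
    then show ?thesis using pr z by (simp add: proper_fun_def)
  qed
  then show ?thesis using p(1) by (auto simp: is_arg_min_def not_less intro!: exI[of _ p])
qed

subsection \<open>Proximal random reshuffling\<close>

lemma random_perm_support:
  "set_pmf (random_perm N) = {\<pi>. \<pi> permutes {..<N}}" "finite (set_pmf (random_perm N))"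
proof -
  have "finite {\<pi>. \<pi> permutes {..<N}}" by (rule finite_permutations) simp
  moreover have "{\<pi>. \<pi> permutes {..<N}} \<noteq> {}" using permutes_id by blast
  ultimately show "set_pmf (random_perm N) = {\<pi>. \<pi> permutes {..<N}}"
    "finite (set_pmf (random_perm N))"
    by (simp_all add: random_perm_def set_pmf_of_set)
qed

lemma expectation_mono_finite:
  fixes f g :: "'a \<Rightarrow> real"
  assumes "finite (set_pmf p)" "\<And>x. x \<in> set_pmf p \<Longrightarrow> f x \<le> g x"
  shows "measure_pmf.expectation p f \<le> measure_pmf.expectation p g"
  using assms by (intro integral_mono_AE integrable_measure_pmf_finite AE_pmfI) auto

lemma expectation_sum_finite:
  fixes f :: "'i \<Rightarrow> 'a \<Rightarrow> real"
  assumes "finite (set_pmf p)"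
  shows "measure_pmf.expectation p (\<lambda>x. \<Sum>i\<in>I. f i x) = (\<Sum>i\<in>I. measure_pmf.expectation p (f i))"
  using assms by (intro Bochner_Integration.integral_sum integrable_measure_pmf_finite)

lemma expectation_affine_finite:
  fixes f :: "'a \<Rightarrow> real"
  assumes "finite (set_pmf p)"
  shows "measure_pmf.expectation p (\<lambda>x. a + b * f x) = a + b * measure_pmf.expectation p f"
  using integrable_measure_pmf_finite[OF assms, of f] by simp

text \<open>Convexity and smoothness of the components enter only as two-sided bounds on their
  Bregman divergences, with one constant \<open>M\<close> for all of them.\<close>

locale finite_sum_problem =
  fixes d :: nat and gs :: "((nat \<Rightarrow> real) \<Rightarrow> real) list" and \<psi> :: "(nat \<Rightarrow> real) \<Rightarrow> ereal"
    and \<mu> M :: real and xs :: "nat \<Rightarrow> real"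
  assumes gs_nonempty: "gs \<noteq> []"
    and M_pos: "0 < M" and \<mu>_pos: "0 < \<mu>"
    and grad_RR: "\<And>g x. g \<in> set gs \<Longrightarrow> x \<in> RR d \<Longrightarrow> grad d g x \<in> RR d"
    and component_bregman_nonneg:
      "\<And>g x y. g \<in> set gs \<Longrightarrow> x \<in> RR d \<Longrightarrow> y \<in> RR d \<Longrightarrow> 0 \<le> bregman d g x y"
    and component_bregman_le:
      "\<And>g x y. g \<in> set gs \<Longrightarrow> x \<in> RR d \<Longrightarrow> y \<in> RR d \<Longrightarrow> bregman d g x y \<le> M / 2 * (enorm d (x - y))\<^sup>2"
    and proper: "proper_fun d \<psi>" and closed: "closed_fun d \<psi>"
    and strongly_convex: "strongly_convex_fun d \<mu> \<psi>"
    and minimizer: "minimizer d gs \<psi> xs"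
begin

section \<open>Optimality at the minimizer and the proximal step\<close>

abbreviation N :: nat where "N \<equiv> length gs"

lemma N_pos: "0 < N" using gs_nonempty by simp

lemma xs_RR: "xs \<in> RR d"
  using minimizer by (simp add: minimizer_def is_arg_min_def)

text \<open>The gradient of the smooth part of the objective at \<open>xs\<close>, written directly
  as an average of component gradients.\<close>

definition mean_grad :: "nat \<Rightarrow> real" where
  "mean_grad = (\<lambda>i. 1 / real N * (\<Sum>j<N. grad d (gs ! j) xs i))"

lemma average_upper_bound:
  assumes z: "z \<in> RR d"
  shows "(\<Sum>g\<leftarrow>gs. g z) / real N \<le>
    (\<Sum>g\<leftarrow>gs. g xs) / real N + einner d mean_grad (z - xs) + M / 2 * (enorm d (z - xs))\<^sup>2"
proof -
  let ?q = "M / 2 * (enorm d (z - xs))\<^sup>2"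
  have "(\<Sum>j<N. (gs ! j) z) \<le> (\<Sum>j<N. (gs ! j) xs + einner d (grad d (gs ! j) xs) (z - xs) + ?q)"
  proof (rule sum_mono)
    fix j assume "j \<in> {..<N}"
    then show "(gs ! j) z \<le> (gs ! j) xs + einner d (grad d (gs ! j) xs) (z - xs) + ?q"
      using component_bregman_le[OF _ z xs_RR, of "gs ! j"] by (simp add: bregman_def)
  qed
  also have "\<dots> = (\<Sum>j<N. (gs ! j) xs) + real N * einner d mean_grad (z - xs) + real N * ?q"
    unfolding mean_grad_def einner_linear_left sum.distrib using N_pos by simp
  finally have "(\<Sum>g\<leftarrow>gs. g z) \<le> (\<Sum>g\<leftarrow>gs. g xs) + real N * einner d mean_grad (z - xs) + real N * ?q"
    by (simp add: sum_list_sum_nth atLeast0LessThan)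
  then show ?thesis using N_pos by (simp add: field_simps)
qed

lemma \<psi>_real:
  assumes "z \<in> RR d" "\<psi> z \<noteq> \<infinity>"
  obtains a where "\<psi> z = ereal a"
  using assms proper by (cases "\<psi> z") (auto simp: proper_fun_def)

lemma \<psi>_minimum:
  assumes "z \<in> RR d"
  shows "ereal ((\<Sum>g\<leftarrow>gs. g xs) / real N) + \<psi> xs \<le> ereal ((\<Sum>g\<leftarrow>gs. g z) / real N) + \<psi> z"
  using minimizer assms by (auto simp: minimizer_def is_arg_min_def objective_def not_less)

lemma \<psi>_xs_real: obtains a where "\<psi> xs = ereal a"
proof -
  obtain z where z: "z \<in> RR d" "\<psi> z \<noteq> \<infinity>" using proper by (auto simp: proper_fun_def)
  have "\<psi> xs \<noteq> \<infinity>"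
  proof
    assume "\<psi> xs = \<infinity>"
    then show False using \<psi>_minimum[OF z(1)] z(2) by simp
  qed
  with \<psi>_real[OF xs_RR] that show thesis by blast
qed

text \<open>Optimality of \<open>xs\<close>: \<open>-mean_grad\<close> is a strong subgradient of
  \<open>\<psi>\<close> there. It serves both as the affine minorant for the existence of proximal
  points and in the contraction estimate.\<close>

lemma \<psi>_lower_bound:
  assumes "z \<in> RR d" "\<psi> xs = ereal a" "\<psi> z = ereal b"
  shows "a - einner d mean_grad (z - xs) + \<mu> / 2 * (enorm d (z - xs))\<^sup>2 \<le> b"
  by (rule strongly_convex_minimizer_bound[where F = "\<lambda>z. (\<Sum>g\<leftarrow>gs. g z) / real N" and c = "M / 2",
        OF strongly_convex proper xs_RR assms average_upper_bound \<psi>_minimum])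

lemma prox_is_arg_min:
  assumes "0 < \<eta>"
  shows "is_arg_min (\<lambda>z. ereal \<eta> * \<psi> z + ereal (1 / 2 * (enorm d (z - y))\<^sup>2)) (\<lambda>z. z \<in> RR d)
    (prox d \<eta> \<psi> y)"
proof -
  obtain a where a: "\<psi> xs = ereal a" by (rule \<psi>_xs_real)
  have "ereal ((a + einner d mean_grad xs) + einner d (\<lambda>i. (-1) * mean_grad i) z) \<le> \<psi> z"
    if z: "z \<in> RR d" for z
  proof (cases "\<psi> z = \<infinity>")
    case False
    with \<psi>_real z obtain b where b: "\<psi> z = ereal b" by blast
    have "0 \<le> \<mu> / 2 * (enorm d (z - xs))\<^sup>2" using \<mu>_pos by simp
    then have "(a + einner d mean_grad xs) + einner d (\<lambda>i. (-1) * mean_grad i) z \<le> b"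
      using \<psi>_lower_bound[OF z a b] unfolding einner_linear_left(4) einner_linear_right(1) by linarith
    then show ?thesis by (simp only: b ereal_less_eq)
  qed simp
  from prox_minimizer_exists[OF closed proper assms this] show ?thesis
    unfolding prox_def arg_min_def by (rule someI_ex)
qed

lemma prox_RR: "0 < \<eta> \<Longrightarrow> prox d \<eta> \<psi> y \<in> RR d"
  using prox_is_arg_min by (simp add: is_arg_min_def)

text \<open>Strong subgradient inequalities at \<open>p\<close> towards \<open>xs\<close> and at
  \<open>xs\<close> towards \<open>p\<close> are added. The values of \<open>\<psi>\<close> cancel,
  and Cauchy-Schwarz does the rest.\<close>

lemma prox_contraction:
  assumes \<eta>: "0 < \<eta>"
  shows "(1 + 2 * \<eta> * \<mu>) * (enorm d (prox d \<eta> \<psi> y - xs))\<^sup>2 \<le>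
    (enorm d (y - (\<lambda>i. xs i - \<eta> * mean_grad i)))\<^sup>2"
proof -
  define p where "p = prox d \<eta> \<psi> y"
  define ys where "ys = (\<lambda>i. xs i - \<eta> * mean_grad i)"
  define D where "D = enorm d (p - xs)"
  define v where "v = p - y"
  have p: "p \<in> RR d" unfolding p_def by (rule prox_RR[OF \<eta>])
  have min: "ereal \<eta> * \<psi> p + ereal (1 / 2 * (enorm d (p - y))\<^sup>2) \<le>
      ereal \<eta> * \<psi> z + ereal (1 / 2 * (enorm d (z - y))\<^sup>2)" if "z \<in> RR d" for z
    using prox_is_arg_min[OF \<eta>, of y] that by (auto simp: is_arg_min_def p_def not_less)
  obtain a where a: "\<psi> xs = ereal a" by (rule \<psi>_xs_real)
  have "\<psi> p \<noteq> \<infinity>" using min[OF xs_RR] \<eta> by (auto simp: a)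
  then obtain b where b: "\<psi> p = ereal b" using \<psi>_real p by blast
  \<comment> \<open>Optimality of \<open>p\<close> after dividing the proximal objective by
    \<open>\<eta>\<close>: the quadratic part has gradient \<open>(p - y) / \<eta>\<close> at
    \<open>p\<close>.\<close>
  have "b - einner d (\<lambda>i. (1 / \<eta>) * v i) (xs - p) + \<mu> / 2 * (enorm d (xs - p))\<^sup>2 \<le> a"
  proof (rule strongly_convex_minimizer_bound[where F = "\<lambda>z. 1 / (2 * \<eta>) * (enorm d (z - y))\<^sup>2"
        and c = "1 / (2 * \<eta>)", OF strongly_convex proper p xs_RR b a])
    fix z assume z: "z \<in> RR d"
    have "(enorm d (z - y))\<^sup>2 = (enorm d (p - y))\<^sup>2 + 2 * einner d (p - y) (z - p) + (enorm d (z - p))\<^sup>2"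
      by (simp add: einner_simps einner_commute[of d z y] einner_commute[of d z p] einner_commute[of d p y])
    then have "(enorm d (z - y))\<^sup>2 = (enorm d (p - y))\<^sup>2 + 2 * einner d v (z - p) + (enorm d (z - p))\<^sup>2"
      by (simp only: v_def)
    then show "1 / (2 * \<eta>) * (enorm d (z - y))\<^sup>2 \<le> 1 / (2 * \<eta>) * (enorm d (p - y))\<^sup>2 +
        einner d (\<lambda>i. (1 / \<eta>) * v i) (z - p) + 1 / (2 * \<eta>) * (enorm d (z - p))\<^sup>2"
      unfolding einner_linear_left(4) using \<eta> by (simp add: field_simps)
    show "ereal (1 / (2 * \<eta>) * (enorm d (p - y))\<^sup>2) + \<psi> p \<le> ereal (1 / (2 * \<eta>) * (enorm d (z - y))\<^sup>2) + \<psi> z"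
    proof (cases "\<psi> z = \<infinity>")
      case False
      with \<psi>_real z obtain e where e: "\<psi> z = ereal e" by blast
      have "1 / \<eta> * (\<eta> * b + 1 / 2 * (enorm d (p - y))\<^sup>2) \<le> 1 / \<eta> * (\<eta> * e + 1 / 2 * (enorm d (z - y))\<^sup>2)"
        using min[OF z] \<eta> by (intro mult_left_mono) (simp_all add: b e)
      then show ?thesis using \<eta> by (simp add: b e distrib_left mult.commute add.commute)
    qed simp
  qed
  then have "b - 1 / \<eta> * einner d (p - y) (xs - p) + \<mu> / 2 * (enorm d (xs - p))\<^sup>2 \<le> a"
    unfolding einner_linear_left(4) v_def .
  moreover have "a - einner d mean_grad (p - xs) + \<mu> / 2 * D\<^sup>2 \<le> b"
    using \<psi>_lower_bound[OF p a b] by (simp add: D_def)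
  moreover have "(enorm d (xs - p))\<^sup>2 = D\<^sup>2"
    by (simp add: D_def einner_simps)
  ultimately have "\<mu> * D\<^sup>2 \<le> 1 / \<eta> * einner d (p - y) (xs - p) + einner d mean_grad (p - xs)"
    by (simp add: field_simps)
  then have "\<eta> * (\<mu> * D\<^sup>2) \<le> \<eta> * (1 / \<eta> * einner d (p - y) (xs - p) + einner d mean_grad (p - xs))"
    using \<eta> by (simp add: mult_left_mono)
  also have "\<dots> = einner d (p - y) (xs - p) + \<eta> * einner d mean_grad (p - xs)"
    using \<eta> by (simp add: distrib_left)
  \<comment> \<open>Writing \<open>p - y\<close> as \<open>(p - xs) - (y - xs)\<close> isolates
    \<open>-D^2\<close>; the remaining terms combine to \<open>y - ys\<close>.\<close>
  also have "\<dots> = einner d (y - ys) (p - xs) - D\<^sup>2"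
    unfolding ys_def D_def
    by (simp add: einner_simps einner_commute[of d xs p] algebra_simps)
  finally have "(1 + \<eta> * \<mu>) * D\<^sup>2 \<le> enorm d (y - ys) * D"
    using einner_le_enorm[of d "y - ys" "p - xs"] by (simp add: algebra_simps D_def)
  then have "(1 + \<eta> * \<mu>) * D \<le> enorm d (y - ys)"
    by (cases "D = 0") (simp_all add: D_def power2_eq_square mult_le_cancel_right order.strict_iff_order)
  then have "((1 + \<eta> * \<mu>) * D)\<^sup>2 \<le> (enorm d (y - ys))\<^sup>2"
    using \<eta> \<mu>_pos by (intro power_mono) (auto simp: D_def)
  \<comment> \<open>The square \<open>(\<eta> * \<mu> * D)^2\<close> is dropped.\<close>
  moreover have "(1 + 2 * \<eta> * \<mu>) * D\<^sup>2 \<le> ((1 + \<eta> * \<mu>) * D)\<^sup>2"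
    by (simp add: power_mult_distrib power2_sum mult_right_mono)
  ultimately show ?thesis by (simp add: D_def p_def ys_def)
qed

text \<open>In the expanded square the three-point identity rewrites the cross term, and
  cocoercivity with \<open>\<gamma> <= 1 / M\<close> lets its part \<open>D(x, xs)\<close> cancel
  the squared gradient difference. The term \<open>-2 * \<gamma> * D(c, x)\<close> is
  discarded.\<close>

lemma inner_step:
  assumes \<gamma>: "0 < \<gamma>" "\<gamma> \<le> 1 / M" and g: "g \<in> set gs" and x: "x \<in> RR d" and c: "c \<in> RR d"
  shows "(enorm d ((\<lambda>i. x i - \<gamma> * grad d g x i) - (\<lambda>i. c i - \<gamma> * grad d g xs i)))\<^sup>2 \<le>
    (enorm d (x - c))\<^sup>2 + 2 * \<gamma> * bregman d g c xs"
proof -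
  define w where "w = grad d g x - grad d g xs"
  define v where "v = x - c"
  have "(enorm d ((\<lambda>i. x i - \<gamma> * grad d g x i) - (\<lambda>i. c i - \<gamma> * grad d g xs i)))\<^sup>2 =
      (enorm d (\<lambda>i. v i - \<gamma> * w i))\<^sup>2"
    by (rule arg_cong[where f = "\<lambda>v. (enorm d v)\<^sup>2"]) (auto simp: w_def v_def algebra_simps)
  also have "\<dots> = (enorm d v)\<^sup>2 - 2 * \<gamma> * einner d w v + \<gamma> * (\<gamma> * (enorm d w)\<^sup>2)"
    by (simp add: einner_simps einner_commute[of d v w] algebra_simps)
  also have "einner d w v = bregman d g c x + bregman d g x xs - bregman d g c xs"
    unfolding w_def v_def by (rule bregman_three_points)
  also have "\<gamma> * (\<gamma> * (enorm d w)\<^sup>2) \<le> \<gamma> * (2 * bregman d g x xs)"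
  proof -
    have "(enorm d w)\<^sup>2 \<le> 2 * M * bregman d g x xs"
      unfolding w_def
      using M_pos x xs_RR grad_RR[OF g] component_bregman_nonneg[OF g] component_bregman_le[OF g]
      by (rule bregman_cocoercive)
    then have "\<gamma> * (enorm d w)\<^sup>2 \<le> 1 / M * (2 * M * bregman d g x xs)"
      using \<gamma> M_pos by (intro mult_mono) auto
    then show ?thesis using \<gamma> M_pos by simp
  qed
  also have "(enorm d v)\<^sup>2 - 2 * \<gamma> * (bregman d g c x + bregman d g x xs - bregman d g c xs) +
      \<gamma> * (2 * bregman d g x xs) =
      (enorm d v)\<^sup>2 + 2 * \<gamma> * bregman d g c xs - 2 * (\<gamma> * bregman d g c x)"
    by (simp add: right_diff_distrib distrib_left)
  also have "\<dots> \<le> (enorm d v)\<^sup>2 + 2 * \<gamma> * bregman d g c xs"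
    using mult_nonneg_nonneg[OF less_imp_le[OF \<gamma>(1)] component_bregman_nonneg[OF g c x]] by linarith
  finally show ?thesis by (simp only: v_def)
qed

section \<open>Inner iterates against reference iterates over one epoch\<close>

lemma permuted_component: "\<pi> permutes {..<N} \<Longrightarrow> k < N \<Longrightarrow> gs ! \<pi> k \<in> set gs"
  using permutes_in_image by fastforce

lemma sol_iterate_RR:
  assumes "\<pi> permutes {..<N}" "k \<le> N"
  shows "sol_iterate d gs \<gamma> \<pi> xs k \<in> RR d"
proof -
  have "grad d (gs ! \<pi> j) xs i = 0" if "j < k" "d \<le> i" for i j
    using grad_RR[OF permuted_component[OF assms(1), of j] xs_RR] assms that by (simp add: RR_iff)
  then show ?thesis using xs_RR by (simp add: sol_iterate_def RR_iff)
qed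

lemma inner_iterate_RR:
  assumes \<pi>: "\<pi> permutes {..<N}" and x: "x \<in> RR d"
  shows "k \<le> N \<Longrightarrow> inner_iterate d gs \<gamma> \<pi> x k \<in> RR d"
proof (induction k)
  case (Suc k)
  then show ?case
    using grad_RR[OF permuted_component[OF \<pi>, of k]] by (auto simp: Let_def RR_iff)
qed (use x in simp)

text \<open>The error accumulated in one epoch. It depends on the permutation but not on the
  starting point of the epoch, which serves both sampling schemes.\<close>

definition path_error :: "real \<Rightarrow> (nat \<Rightarrow> nat) \<Rightarrow> real" where
  "path_error \<gamma> \<pi> = (\<Sum>k<N. bregman d (gs ! \<pi> k) (sol_iterate d gs \<gamma> \<pi> xs k) xs)"

lemma inner_iterate_bound:
  assumes \<gamma>: "0 < \<gamma>" "\<gamma> \<le> 1 / M" and \<pi>: "\<pi> permutes {..<N}" and x: "x \<in> RR d"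
  shows "k \<le> N \<Longrightarrow> (enorm d (inner_iterate d gs \<gamma> \<pi> x k - sol_iterate d gs \<gamma> \<pi> xs k))\<^sup>2 \<le>
    (enorm d (x - xs))\<^sup>2 + 2 * \<gamma> * (\<Sum>j<k. bregman d (gs ! \<pi> j) (sol_iterate d gs \<gamma> \<pi> xs j) xs)"
proof (induction k)
  case 0
  then show ?case by (simp add: sol_iterate_def)
next
  case (Suc k)
  let ?x = "inner_iterate d gs \<gamma> \<pi> x k" and ?c = "sol_iterate d gs \<gamma> \<pi> xs k" and ?g = "gs ! \<pi> k"
  have k: "k < N" using Suc by simp
  have "sol_iterate d gs \<gamma> \<pi> xs (Suc k) = (\<lambda>i. ?c i - \<gamma> * grad d ?g xs i)"
    by (auto simp: sol_iterate_def algebra_simps)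
  then have "(enorm d (inner_iterate d gs \<gamma> \<pi> x (Suc k) - sol_iterate d gs \<gamma> \<pi> xs (Suc k)))\<^sup>2 =
      (enorm d ((\<lambda>i. ?x i - \<gamma> * grad d ?g ?x i) - (\<lambda>i. ?c i - \<gamma> * grad d ?g xs i)))\<^sup>2"
    by (simp add: Let_def)
  also have "\<dots> \<le> (enorm d (?x - ?c))\<^sup>2 + 2 * \<gamma> * bregman d ?g ?c xs"
    using k by (intro inner_step \<gamma> permuted_component \<pi> inner_iterate_RR x sol_iterate_RR) auto
  finally show ?case using Suc k unfolding sum.lessThan_Suc distrib_left by linarith
qed

lemma epoch_RR: "0 < \<gamma> \<Longrightarrow> epoch d gs \<psi> \<gamma> \<pi> x \<in> RR d"
  using N_pos by (simp add: epoch_def prox_RR)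

text \<open>A full pass sums all gradients at \<open>xs\<close>, whatever their order, so the last
  reference iterate is \<open>xs - \<gamma> * N * mean_grad\<close>. This is the centre in
  \<open>prox_contraction\<close> with \<open>\<eta> = \<gamma> * N\<close>.\<close>

lemma epoch_bound:
  assumes \<gamma>: "0 < \<gamma>" "\<gamma> \<le> 1 / M" and \<pi>: "\<pi> permutes {..<N}" and x: "x \<in> RR d"
  shows "(1 + 2 * \<gamma> * real N * \<mu>) * (enorm d (epoch d gs \<psi> \<gamma> \<pi> x - xs))\<^sup>2 \<le>
    (enorm d (x - xs))\<^sup>2 + 2 * \<gamma> * path_error \<gamma> \<pi>"
proof -
  have "(\<Sum>j<N. grad d (gs ! \<pi> j) xs i) = (\<Sum>j<N. grad d (gs ! j) xs i)" for i
    by (rule sum.reindex_bij_betw[OF permutes_imp_bij[OF \<pi>]])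
  then have "sol_iterate d gs \<gamma> \<pi> xs N = (\<lambda>i. xs i - \<gamma> * real N * mean_grad i)"
    using N_pos by (simp add: sol_iterate_def mean_grad_def)
  then show ?thesis
    using prox_contraction[of "\<gamma> * real N" "inner_iterate d gs \<gamma> \<pi> x N"]
      inner_iterate_bound[OF assms order_refl] \<gamma> N_pos
    by (simp add: epoch_def path_error_def algebra_simps)
qed

lemma sigma_rad_sq_bounds:
  assumes \<gamma>: "0 < \<gamma>"
  shows "0 \<le> sigma_rad_sq d gs \<gamma> xs"
    and "k < N \<Longrightarrow> measure_pmf.expectation (random_perm N)
      (\<lambda>\<pi>. bregman d (gs ! \<pi> k) (sol_iterate d gs \<gamma> \<pi> xs k) xs) \<le> \<gamma>\<^sup>2 * sigma_rad_sq d gs \<gamma> xs"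
proof -
  let ?e = "\<lambda>k. measure_pmf.expectation (random_perm N)
      (\<lambda>\<pi>. bregman d (gs ! \<pi> k) (sol_iterate d gs \<gamma> \<pi> xs k) xs)"
  have e_nonneg: "0 \<le> ?e k" if "k < N" for k
  proof (intro integral_nonneg_AE AE_pmfI)
    fix \<pi> assume "\<pi> \<in> set_pmf (random_perm N)"
    then have \<pi>: "\<pi> permutes {..<N}" by (simp add: random_perm_support)
    show "0 \<le> bregman d (gs ! \<pi> k) (sol_iterate d gs \<gamma> \<pi> xs k) xs"
      using that by (intro component_bregman_nonneg permuted_component[OF \<pi>] sol_iterate_RR[OF \<pi>] xs_RR) auto
  qed
  have le: "1 / \<gamma>\<^sup>2 * ?e k \<le> sigma_rad_sq d gs \<gamma> xs" if "1 \<le> k" "k < N" for k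
    using that by (auto simp: sigma_rad_sq_def intro!: Max_ge)
  show nn: "0 \<le> sigma_rad_sq d gs \<gamma> xs"
  proof (cases "N \<le> 1")
    case False
    then show ?thesis
      using le[of 1] e_nonneg[of 1] \<gamma> by (smt (verit) divide_nonneg_nonneg mult_nonneg_nonneg
          zero_le_power2 not_le order_refl)
  qed (simp add: sigma_rad_sq_def)
  assume k: "k < N"
  show "?e k \<le> \<gamma>\<^sup>2 * sigma_rad_sq d gs \<gamma> xs"
  \<comment> \<open>Index 0 is absent from the maximum; there the reference iterate is
    \<open>xs\<close> itself and the divergence is 0.\<close>
  proof (cases k)
    case 0
    then show ?thesis using nn by (simp add: sol_iterate_def bregman_def einner_def)
  next
    case (Suc k')
    then show ?thesis using le[of k] k \<gamma> by (simp add: field_simps)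
  qed
qed

lemma expectation_path_error:
  assumes \<gamma>: "0 < \<gamma>"
  shows "measure_pmf.expectation (random_perm N) (path_error \<gamma>) \<le>
    real N * (\<gamma>\<^sup>2 * (sigma_rad d gs \<gamma> xs)\<^sup>2)"
proof -
  have "measure_pmf.expectation (random_perm N) (path_error \<gamma>) =
      (\<Sum>k<N. measure_pmf.expectation (random_perm N)
        (\<lambda>\<pi>. bregman d (gs ! \<pi> k) (sol_iterate d gs \<gamma> \<pi> xs k) xs))"
    unfolding path_error_def[abs_def] by (rule expectation_sum_finite) (rule random_perm_support)
  also have "\<dots> \<le> (\<Sum>k<N. \<gamma>\<^sup>2 * sigma_rad_sq d gs \<gamma> xs)"
    by (rule sum_mono) (simp add: sigma_rad_sq_bounds[OF \<gamma>])
  finally show ?thesis using sigma_rad_sq_bounds[OF \<gamma>] by (simp add: sigma_rad_def)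
qed

section \<open>Recursion over the epochs\<close>

definition rate :: "real \<Rightarrow> real" where "rate \<gamma> = 1 / (1 + 2 * \<gamma> * real N * \<mu>)"

lemma rate_pos: "0 < \<gamma> \<Longrightarrow> 0 < rate \<gamma>"
  using \<mu>_pos by (simp add: rate_def add_pos_nonneg)

lemma epoch_rate:
  assumes "0 < \<gamma>" "\<gamma> \<le> 1 / M" "\<pi> permutes {..<N}" "x \<in> RR d"
  shows "(enorm d (epoch d gs \<psi> \<gamma> \<pi> x - xs))\<^sup>2 \<le>
    rate \<gamma> * ((enorm d (x - xs))\<^sup>2 + 2 * \<gamma> * path_error \<gamma> \<pi>)"
proof -
  have "0 < 1 + 2 * \<gamma> * real N * \<mu>" using assms(1) \<mu>_pos by (simp add: add_pos_nonneg)
  then show ?thesis using epoch_bound[OF assms] by (simp add: rate_def field_simps)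
qed

text \<open>The constant \<open>s / (\<mu> N)\<close> is the fixed point of \<open>c \<mapsto> rate \<gamma> (c + 2 \<gamma> s)\<close>.\<close>

lemma rate_fixed_point:
  assumes "0 < \<gamma>"
  shows "rate \<gamma> * (a + s / (\<mu> * real N) + 2 * \<gamma> * s) = rate \<gamma> * a + s / (\<mu> * real N)"
proof -
  have "1 + 2 * \<gamma> * real N * \<mu> \<noteq> 0"
    using assms \<mu>_pos by (metis add_pos_nonneg less_irrefl less_imp_le mult_nonneg_nonneg of_nat_0_le_iff zero_less_one zero_le_numeral)
  then show ?thesis using N_pos \<mu>_pos by (simp add: rate_def field_simps)
qed

text \<open>The same permutation drives all epochs, so the recursion is unrolled for each fixed
  permutation and the expectation is taken only at the end.\<close>

lemma prox_so_bound:
  assumes \<gamma>: "0 < \<gamma>" "\<gamma> \<le> 1 / M" and x0: "x0 \<in> RR d"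
  shows "measure_pmf.expectation (prox_so d gs \<psi> \<gamma> x0 T) (\<lambda>x. (enorm d (x - xs))\<^sup>2) \<le>
    rate \<gamma> ^ T * (enorm d (x0 - xs))\<^sup>2 + \<gamma>\<^sup>2 * (sigma_rad d gs \<gamma> xs)\<^sup>2 / \<mu>"
proof -
  let ?X = "\<lambda>\<pi> t. (epoch d gs \<psi> \<gamma> \<pi> ^^ t) x0"
  have RR: "?X \<pi> t \<in> RR d" for \<pi> t
    using x0 epoch_RR[OF \<gamma>(1)] by (cases t) auto
  have bound: "(enorm d (?X \<pi> t - xs))\<^sup>2 \<le>
      rate \<gamma> ^ t * (enorm d (x0 - xs))\<^sup>2 + 1 / (\<mu> * real N) * path_error \<gamma> \<pi>"
    if \<pi>: "\<pi> permutes {..<N}" for \<pi> t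
  proof (induction t)
    case 0
    have "0 \<le> path_error \<gamma> \<pi>"
      unfolding path_error_def
      by (intro sum_nonneg component_bregman_nonneg permuted_component[OF \<pi>] sol_iterate_RR[OF \<pi>] xs_RR) auto
    then show ?case using \<mu>_pos by simp
  next
    case (Suc t)
    have "(enorm d (?X \<pi> (Suc t) - xs))\<^sup>2 \<le> rate \<gamma> * ((enorm d (?X \<pi> t - xs))\<^sup>2 + 2 * \<gamma> * path_error \<gamma> \<pi>)"
      using epoch_rate[OF \<gamma> \<pi> RR] by simp
    also have "\<dots> \<le> rate \<gamma> * (rate \<gamma> ^ t * (enorm d (x0 - xs))\<^sup>2 + 1 / (\<mu> * real N) * path_error \<gamma> \<pi>
        + 2 * \<gamma> * path_error \<gamma> \<pi>)"
      by (intro mult_left_mono add_right_mono Suc less_imp_le rate_pos \<gamma>)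
    finally show ?case
      using rate_fixed_point[OF \<gamma>(1), of "rate \<gamma> ^ t * (enorm d (x0 - xs))\<^sup>2" "path_error \<gamma> \<pi>"]
      by (simp add: fun_diff_def)
  qed
  have "measure_pmf.expectation (prox_so d gs \<psi> \<gamma> x0 T) (\<lambda>x. (enorm d (x - xs))\<^sup>2) \<le>
      measure_pmf.expectation (random_perm N)
        (\<lambda>\<pi>. rate \<gamma> ^ T * (enorm d (x0 - xs))\<^sup>2 + 1 / (\<mu> * real N) * path_error \<gamma> \<pi>)"
    unfolding prox_so_def integral_map_pmf
    by (rule expectation_mono_finite, rule random_perm_support)
      (simp only: random_perm_support(1) mem_Collect_eq bound)
  also have "\<dots> = rate \<gamma> ^ T * (enorm d (x0 - xs))\<^sup>2 +
      1 / (\<mu> * real N) * measure_pmf.expectation (random_perm N) (path_error \<gamma>)"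
    by (rule expectation_affine_finite) (rule random_perm_support)
  also have "\<dots> \<le> rate \<gamma> ^ T * (enorm d (x0 - xs))\<^sup>2 +
      1 / (\<mu> * real N) * (real N * (\<gamma>\<^sup>2 * (sigma_rad d gs \<gamma> xs)\<^sup>2))"
    using expectation_path_error[OF \<gamma>(1)] \<mu>_pos by (intro add_left_mono mult_left_mono) auto
  finally show ?thesis using N_pos by simp
qed

lemma prox_rr_support:
  assumes "0 < \<gamma>" "x0 \<in> RR d"
  shows "finite (set_pmf (prox_rr d gs \<psi> \<gamma> x0 t)) \<and> set_pmf (prox_rr d gs \<psi> \<gamma> x0 t) \<subseteq> RR d"
  using assms by (induction t) (auto simp: random_perm_support(2) epoch_RR)

text \<open>Each fresh permutation is independent of the current iterate, so the expectation is
  taken epoch by epoch, conditionally on that iterate.\<close>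

lemma prox_rr_bound:
  assumes \<gamma>: "0 < \<gamma>" "\<gamma> \<le> 1 / M" and x0: "x0 \<in> RR d"
  shows "measure_pmf.expectation (prox_rr d gs \<psi> \<gamma> x0 T) (\<lambda>x. (enorm d (x - xs))\<^sup>2) \<le>
    rate \<gamma> ^ T * (enorm d (x0 - xs))\<^sup>2 + \<gamma>\<^sup>2 * (sigma_rad d gs \<gamma> xs)\<^sup>2 / \<mu>"
proof (induction T)
  case 0
  then show ?case using \<mu>_pos by simp
next
  case (Suc t)
  let ?p = "prox_rr d gs \<psi> \<gamma> x0 t" and ?e = "\<lambda>x. (enorm d (x - xs))\<^sup>2"
  define s where "s = real N * (\<gamma>\<^sup>2 * (sigma_rad d gs \<gamma> xs)\<^sup>2)"
  have IH: "measure_pmf.expectation ?p ?e \<le> rate \<gamma> ^ t * ?e x0 + s / (\<mu> * real N)"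
    using Suc N_pos by (simp add: s_def fun_diff_def)
  note supp = prox_rr_support[OF \<gamma>(1) x0, of t]
  have one_epoch: "measure_pmf.expectation (map_pmf (\<lambda>\<pi>. epoch d gs \<psi> \<gamma> \<pi> x) (random_perm N)) ?e \<le>
      rate \<gamma> * 2 * \<gamma> * s + rate \<gamma> * ?e x" if x: "x \<in> RR d" for x
  proof -
    have "measure_pmf.expectation (map_pmf (\<lambda>\<pi>. epoch d gs \<psi> \<gamma> \<pi> x) (random_perm N)) ?e \<le>
        measure_pmf.expectation (random_perm N) (\<lambda>\<pi>. rate \<gamma> * ?e x + rate \<gamma> * 2 * \<gamma> * path_error \<gamma> \<pi>)"
      unfolding integral_map_pmf
    proof (rule expectation_mono_finite)
      fix \<pi> assume "\<pi> \<in> set_pmf (random_perm N)"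
      then have "\<pi> permutes {..<N}" by (simp add: random_perm_support)
      from epoch_rate[OF \<gamma> this x]
      show "?e (epoch d gs \<psi> \<gamma> \<pi> x) \<le> rate \<gamma> * ?e x + rate \<gamma> * 2 * \<gamma> * path_error \<gamma> \<pi>"
        by (simp add: algebra_simps)
    qed (rule random_perm_support)
    also have "\<dots> = rate \<gamma> * ?e x + rate \<gamma> * 2 * \<gamma> * measure_pmf.expectation (random_perm N) (path_error \<gamma>)"
      by (rule expectation_affine_finite) (rule random_perm_support)
    also have "\<dots> \<le> rate \<gamma> * ?e x + rate \<gamma> * 2 * \<gamma> * s"
      unfolding s_def using expectation_path_error[OF \<gamma>(1)] \<gamma> rate_pos[OF \<gamma>(1)]
      by (intro add_left_mono mult_left_mono) auto
    finally show ?thesis by simp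
  qed
  \<comment> \<open>Law of total expectation, a finite sum by
    \<open>prox_rr_support\<close>.\<close>
  have "measure_pmf.expectation (prox_rr d gs \<psi> \<gamma> x0 (Suc t)) ?e =
      (\<Sum>x\<in>set_pmf ?p. pmf ?p x *
        measure_pmf.expectation (map_pmf (\<lambda>\<pi>. epoch d gs \<psi> \<gamma> \<pi> x) (random_perm N)) ?e)"
    using supp by (simp add: pmf_expectation_bind[of "set_pmf ?p"] random_perm_support(2)
        del: integral_map_pmf)
  also have "\<dots> \<le> (\<Sum>x\<in>set_pmf ?p. pmf ?p x * (rate \<gamma> * 2 * \<gamma> * s + rate \<gamma> * ?e x))"
    using supp one_epoch by (intro sum_mono mult_left_mono) auto
  also have "\<dots> = measure_pmf.expectation ?p (\<lambda>x. rate \<gamma> * 2 * \<gamma> * s + rate \<gamma> * ?e x)"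
    using supp by (subst integral_measure_pmf[of "set_pmf ?p"]) auto
  also have "\<dots> = rate \<gamma> * (measure_pmf.expectation ?p ?e + 2 * \<gamma> * s)"
    using supp by (subst expectation_affine_finite) (auto simp: algebra_simps)
  also have "\<dots> \<le> rate \<gamma> * (rate \<gamma> ^ t * ?e x0 + s / (\<mu> * real N) + 2 * \<gamma> * s)"
    by (intro mult_left_mono add_right_mono IH less_imp_le rate_pos \<gamma>)
  also have "\<dots> = rate \<gamma> ^ Suc t * ?e x0 + \<gamma>\<^sup>2 * (sigma_rad d gs \<gamma> xs)\<^sup>2 / \<mu>"
    unfolding rate_fixed_point[OF \<gamma>(1)] using N_pos by (simp add: s_def)
  finally show ?case .
qed

end

text \<open>The bound \<open>ln (1 / (1 + q)) <= -q / (1 + q)\<close> is matched by the factor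
  \<open>1 / q + 1\<close>, the reciprocal of \<open>q / (1 + q)\<close>.\<close>

lemma geometric_decay:
  fixes q a \<epsilon> c :: real
  assumes q: "0 < q" and a: "0 \<le> a" and \<epsilon>: "0 < \<epsilon>" and c: "1 / q \<le> c"
    and T: "(c + 1) * ln (2 * a / \<epsilon>) \<le> real T"
  shows "(1 / (1 + q)) ^ T * a \<le> \<epsilon> / 2"
\<comment> \<open>Here the logarithm is nonpositive, or 0 by default when \<open>a = 0\<close>, so
  \<open>T\<close> may be 0; no decay is required.\<close>
proof (cases "2 * a \<le> \<epsilon>")
  case True
  have "(1 / (1 + q)) ^ T * a \<le> 1 * a"
    using q a by (intro mult_right_mono power_le_one) auto
  then show ?thesis using True by simp
next
  case False
  then have a0: "0 < a" using \<epsilon> by linarith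
  define l where "l = ln (2 * a / \<epsilon>)"
  have l: "0 < l" unfolding l_def using False \<epsilon> by simp
  have "(1 / q + 1) * l \<le> real T" using T c l by (smt (verit) mult_right_mono l_def)
  then have "(1 / q + 1) * l * (q / (1 + q)) \<le> real T * (q / (1 + q))"
    using q by (intro mult_right_mono) auto
  moreover have "(1 / q + 1) * l * (q / (1 + q)) = l"
    using q by (simp add: divide_simps)
  ultimately have 1: "l \<le> real T * (q / (1 + q))" by simp
  have "ln (1 / (1 + q)) \<le> 1 / (1 + q) - 1" using q by (intro ln_le_minus_one) simp
  also have "\<dots> = - (q / (1 + q))" using q by (simp add: field_simps)
  finally have "real T * ln (1 / (1 + q)) \<le> - l"
    using 1 by (smt (verit) mult_left_mono mult_minus_right of_nat_0_le_iff)
  then have "exp (real T * ln (1 / (1 + q))) \<le> exp (- l)" by simp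
  moreover have "exp (real T * ln (1 / (1 + q))) = (1 / (1 + q)) ^ T"
    using q by (simp add: exp_of_nat_mult del: ln_div)
  moreover have "exp (- l) = \<epsilon> / (2 * a)"
    unfolding l_def using a0 \<epsilon> by (simp add: exp_minus)
  ultimately have "(1 / (1 + q)) ^ T \<le> \<epsilon> / (2 * a)" by simp
  then show ?thesis using a0 by (simp add: field_simps)
qed

subsection \<open>Importance resampling\<close>

lemma length_component_list: "length (component_list n L f) = num_components n L"
  by (simp add: component_list_def num_components_def length_concat o_def
      interv_sum_list_conv_sum_set_nat atLeast0LessThan)

lemma Lbar_pos: "problem_setting d n f L \<psi> \<mu> \<Longrightarrow> 0 < Lbar n L"
  unfolding problem_setting_def Lbar_def by (intro divide_pos_pos sum_pos) (auto simp: lessThan_empty_iff)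

text \<open>The lower bound on the ceiling makes every rescaled component
  \<open>Lbar\<close>-smooth; the upper bound limits the number of components.\<close>

lemma copies_bounds:
  assumes "problem_setting d n f L \<psi> \<mu>" "i < n"
  shows "1 \<le> copies n L i" "L i \<le> real (copies n L i) * Lbar n L"
    "real (copies n L i) \<le> L i / Lbar n L + 1"
proof -
  have L: "0 < L i / Lbar n L" using assms Lbar_pos[OF assms(1)] by (simp add: problem_setting_def)
  then have "0 < \<lceil>L i / Lbar n L\<rceil>" by simp
  then show "1 \<le> copies n L i" unfolding copies_def by linarith
  have eq: "real (copies n L i) = real_of_int \<lceil>L i / Lbar n L\<rceil>"
    using \<open>0 < \<lceil>_\<rceil>\<close> by (simp add: copies_def)
  have "L i / Lbar n L \<le> real (copies n L i)" unfolding eq by (rule le_of_int_ceiling)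
  then show "L i \<le> real (copies n L i) * Lbar n L"
    using Lbar_pos[OF assms(1)] by (simp add: field_simps)
  show "real (copies n L i) \<le> L i / Lbar n L + 1"
    unfolding eq by (rule of_int_ceiling_le_add_one)
qed

text \<open>The ratios \<open>L i / Lbar n L\<close> sum to \<open>n\<close>, and rounding up adds
  at most 1 for each index.\<close>

lemma num_components_le:
  assumes "problem_setting d n f L \<psi> \<mu>"
  shows "num_components n L \<le> 2 * n"
proof -
  have "real (num_components n L) \<le> (\<Sum>i<n. L i / Lbar n L + 1)"
    unfolding num_components_def of_nat_sum using copies_bounds[OF assms] by (intro sum_mono) auto
  also have "\<dots> = (\<Sum>i<n. L i) / Lbar n L + real n"
    by (simp add: sum.distrib sum_divide_distrib)
  also have "\<dots> = 2 * real n"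
    using Lbar_pos[OF assms] assms by (simp add: Lbar_def problem_setting_def field_simps)
  finally show ?thesis by linarith
qed

lemma finite_sum_problem_component_list:
  assumes ps: "problem_setting d n f L \<psi> \<mu>" and min: "minimizer d (component_list n L f) \<psi> xs"
  shows "finite_sum_problem d (component_list n L f) \<psi> \<mu> (Lbar n L) xs"
proof
  let ?gs = "component_list n L f"
  have n: "0 < n" using ps by (simp add: problem_setting_def)
  have "0 < num_components n L"
    using copies_bounds(1)[OF ps n] member_le_sum[of 0 "{..<n}" "copies n L"] n
    by (simp add: num_components_def)
  then show "?gs \<noteq> []" by (metis length_component_list length_greater_0_conv)
  show "0 < Lbar n L" by (rule Lbar_pos[OF ps])
  show "0 < \<mu>" "proper_fun d \<psi>" "closed_fun d \<psi>" "strongly_convex_fun d \<mu> \<psi>"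
    using ps by (auto simp: problem_setting_def)
  show "minimizer d ?gs \<psi> xs" by (rule min)
  fix g x assume "g \<in> set ?gs" and x: "x \<in> RR d"
  then obtain i where i: "i < n" and g: "g = (\<lambda>x. 1 / real (copies n L i) * f i x)"
    by (auto simp: component_list_def)
  let ?m = "real (copies n L i)"
  have sm: "smooth d (L i) (f i)" and cv: "convex_fun d (\<lambda>x. ereal (f i x))"
    using ps i by (auto simp: problem_setting_def)
  have "grad d (f i) x \<in> RR d"
    using smooth_has_gradient[OF sm x] by (simp add: has_gradient_def)
  then show "grad d g x \<in> RR d" unfolding g grad_scale[OF sm x] by (simp add: RR_iff)
  fix y assume y: "y \<in> RR d"
  have m: "1 \<le> ?m" using copies_bounds(1)[OF ps i] by simp
  have br: "bregman d g x y = 1 / ?m * bregman d (f i) x y"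
    unfolding g by (rule bregman_scale[OF sm y])
  show "0 \<le> bregman d g x y"
    unfolding br using bregman_nonneg[OF sm cv x y] by simp
  have "bregman d (f i) x y \<le> L i / 2 * (enorm d (x - y))\<^sup>2"
    using sm x y by (simp add: smooth_def)
  also have "\<dots> \<le> (?m * Lbar n L) / 2 * (enorm d (x - y))\<^sup>2"
    using copies_bounds(2)[OF ps i] by (intro mult_right_mono divide_right_mono) auto
  finally have "1 / ?m * bregman d (f i) x y \<le> 1 / ?m * ((?m * Lbar n L) / 2 * (enorm d (x - y))\<^sup>2)"
    by (intro mult_left_mono) auto
  also have "\<dots> = Lbar n L / 2 * (enorm d (x - y))\<^sup>2" using m by simp
  finally show "bregman d g x y \<le> Lbar n L / 2 * (enorm d (x - y))\<^sup>2" unfolding br .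
qed

text \<open>The constant \<open>3 / 2\<close> is \<open>1 / 2\<close> from the decay of the initial
  distance plus 1 from the shuffling error.\<close>

lemma shuffling_complexity:
  fixes \<epsilon> \<gamma> :: real
  assumes ps: "problem_setting d n f L \<psi> \<mu>" and gs: "gs = component_list n L f"
    and min: "minimizer d gs \<psi> xs" and x0: "x0 \<in> RR d" and \<epsilon>: "0 < \<epsilon>" and \<gamma>: "0 < \<gamma>"
    and \<sigma>: "\<sigma> = sigma_rad d gs \<gamma> xs"
    and step: "\<gamma> = (if \<sigma> = 0 then 1 / Lbar n L else min (1 / Lbar n L) (sqrt (\<epsilon> * \<mu>) / \<sigma>))"
    and T: "(Lbar n L / \<mu> + (\<sigma> / \<mu>) / sqrt (\<epsilon> * \<mu>) + real (num_components n L))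
      * ln (2 * (enorm d (x0 - xs))\<^sup>2 / \<epsilon>) \<le> real (num_components n L * T)"
  shows "measure_pmf.expectation (prox_rr d gs \<psi> \<gamma> x0 T) (\<lambda>x. (enorm d (x - xs))\<^sup>2) \<le> 3 / 2 * \<epsilon>"
    and "measure_pmf.expectation (prox_so d gs \<psi> \<gamma> x0 T) (\<lambda>x. (enorm d (x - xs))\<^sup>2) \<le> 3 / 2 * \<epsilon>"
proof -
  interpret finite_sum_problem d gs \<psi> \<mu> "Lbar n L" xs
    unfolding gs by (rule finite_sum_problem_component_list[OF ps min[unfolded gs]])
  have N: "num_components n L = N" by (simp add: gs length_component_list)
  have \<sigma>0: "0 \<le> \<sigma>" by (simp add: \<sigma> sigma_rad_def sigma_rad_sq_bounds[OF \<gamma>])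
  define r where "r = sqrt (\<epsilon> * \<mu>)"
  have r: "0 < r" "r\<^sup>2 = \<epsilon> * \<mu>" using \<epsilon> \<mu>_pos by (auto simp: r_def)
  have \<gamma>M: "\<gamma> \<le> 1 / Lbar n L" by (simp add: step)
  have "\<gamma> * \<sigma> \<le> r"
  proof (cases "\<sigma> = 0")
    case False
    then have "\<gamma> \<le> r / \<sigma>" using step by (simp add: r_def)
    then show ?thesis using False \<sigma>0 by (simp add: field_simps)
  qed (use r in simp)
  then have "(\<gamma> * \<sigma>)\<^sup>2 \<le> r\<^sup>2" using \<gamma> \<sigma>0 by (intro power_mono) auto
  then have noise: "\<gamma>\<^sup>2 * \<sigma>\<^sup>2 / \<mu> \<le> \<epsilon>"
    using \<mu>_pos r by (simp add: power_mult_distrib field_simps)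
  \<comment> \<open>The reciprocal of a minimum is a maximum, here bounded by the sum.\<close>
  have "1 / \<gamma> \<le> Lbar n L + \<sigma> / r"
  proof (cases "\<gamma> = 1 / Lbar n L")
    case True
    then show ?thesis using \<sigma>0 r by simp
  next
    case False
    then have "\<gamma> = r / \<sigma>" using step by (auto simp: r_def min_def split: if_splits)
    then show ?thesis using M_pos by simp
  qed
  then have "1 / \<gamma> / \<mu> \<le> (Lbar n L + \<sigma> / r) / \<mu>"
    using \<mu>_pos by (intro divide_right_mono) auto
  also have "\<dots> = Lbar n L / \<mu> + (\<sigma> / \<mu>) / r" by (simp add: add_divide_distrib)
  finally have inv: "1 / \<gamma> / \<mu> \<le> Lbar n L / \<mu> + (\<sigma> / \<mu>) / r" .
  define c0 where "c0 = Lbar n L / \<mu> + (\<sigma> / \<mu>) / r"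
  \<comment> \<open>Chosen so that \<open>N * (c + 1) = c0 + N\<close>, which turns the bound on
    \<open>N * T\<close> into the bound on \<open>T\<close> required by
    \<open>geometric_decay\<close>.\<close>
  define c where "c = c0 / real N"
  have "1 / (2 * \<gamma> * real N * \<mu>) \<le> 1 / \<gamma> / \<mu> / real N"
    using \<gamma> \<mu>_pos N_pos by (simp add: field_simps)
  also have "\<dots> \<le> c" unfolding c_def c0_def using inv by (intro divide_right_mono) auto
  finally have c: "1 / (2 * \<gamma> * real N * \<mu>) \<le> c" .
  have "real N * ((c + 1) * ln (2 * (enorm d (x0 - xs))\<^sup>2 / \<epsilon>)) \<le> real N * real T"
  proof -
    have "real N * (c + 1) = c0 + real N"
      using N_pos by (simp add: c_def distrib_left)
    then show ?thesis using T by (simp add: N r_def c0_def flip: mult.assoc)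
  qed
  then have "(c + 1) * ln (2 * (enorm d (x0 - xs))\<^sup>2 / \<epsilon>) \<le> real T"
    using N_pos by simp
  from geometric_decay[OF _ _ \<epsilon> c this]
  have "rate \<gamma> ^ T * (enorm d (x0 - xs))\<^sup>2 \<le> \<epsilon> / 2"
    using \<gamma> \<mu>_pos N_pos by (simp add: rate_def)
  with noise have "rate \<gamma> ^ T * (enorm d (x0 - xs))\<^sup>2 + \<gamma>\<^sup>2 * (sigma_rad d gs \<gamma> xs)\<^sup>2 / \<mu> \<le> 3 / 2 * \<epsilon>"
    unfolding \<sigma> by linarith
  with prox_rr_bound[OF \<gamma> \<gamma>M x0, of T] prox_so_bound[OF \<gamma> \<gamma>M x0, of T]
  show "measure_pmf.expectation (prox_rr d gs \<psi> \<gamma> x0 T) (\<lambda>x. (enorm d (x - xs))\<^sup>2) \<le> 3 / 2 * \<epsilon>"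
    "measure_pmf.expectation (prox_so d gs \<psi> \<gamma> x0 T) (\<lambda>x. (enorm d (x - xs))\<^sup>2) \<le> 3 / 2 * \<epsilon>"
    by linarith+
qed

theorem theorem6:
  shows
    "(\<forall>d n f L \<psi> \<mu>. problem_setting d n f L \<psi> \<mu> \<longrightarrow> num_components n L \<le> 2 * n) \<and>
     (\<exists>C::real. C > 0 \<and>
        (\<forall>d n f L \<psi> \<mu> gs xs x0 \<epsilon> \<gamma> \<sigma> T.
           problem_setting d n f L \<psi> \<mu> \<longrightarrow>
           gs = component_list n L f \<longrightarrow>
           minimizer d gs \<psi> xs \<longrightarrow>
           x0 \<in> RR d \<longrightarrow> \<epsilon> > 0 \<longrightarrow> \<gamma> > 0 \<longrightarrow>
           \<sigma> = sigma_rad d gs \<gamma> xs \<longrightarrow>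
           \<gamma> = (if \<sigma> = 0 then 1 / Lbar n L
                else min (1 / Lbar n L) (sqrt (\<epsilon> * \<mu>) / \<sigma>)) \<longrightarrow>
           real (num_components n L * T) \<ge>
             (Lbar n L / \<mu> + (\<sigma> / \<mu>) / sqrt (\<epsilon> * \<mu>) + real (num_components n L))
               * ln (2 * (enorm d (x0 - xs))\<^sup>2 / \<epsilon>) \<longrightarrow>
           measure_pmf.expectation (prox_rr d gs \<psi> \<gamma> x0 T) (\<lambda>x. (enorm d (x - xs))\<^sup>2) \<le> C * \<epsilon> \<and>
           measure_pmf.expectation (prox_so d gs \<psi> \<gamma> x0 T) (\<lambda>x. (enorm d (x - xs))\<^sup>2) \<le> C * \<epsilon>))"
proof (intro conjI)
  show "\<forall>d n f L \<psi> \<mu>. problem_setting d n f L \<psi> \<mu> \<longrightarrow> num_components n L \<le> 2 * n"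
    using num_components_le by blast
qed (intro exI[of _ "3 / 2 :: real"] conjI allI impI, simp, (rule shuffling_complexity; assumption)+)

end
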